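(* Let $M$ be an $m\times n$ integer matrix and $N$ an $l\times n$ matrix with non-negative integer entries and columns $\mathbf b_1,\dots,\mathbf b_n$ (all columns nonzero), with $I_N\subseteq I_M$; let $\phi:K[x_1,\dots,x_n]\to K[t_1,\dots,t_l]$, $\phi(x_i)=\mathbf t^{\mathbf b_i}$, and assume $\Gamma(N)=V(I_N)$ in $\bar K^n$. Let $f_1,\dots,f_s$ be binomials in $I_M$, $J=(f_1,\dots,f_s)$, and $G=\langle \mathbf y_{\widehat{f_1}},\dots,\mathbf y_{\widehat{f_s}}\rangle\subseteq N(\ker_{\mathbb Z}(M))$. If $\mathrm{char}(K)=p\ne0$ (resp. $\mathrm{char}(K)=0$), then $I_M=\mathrm{rad}(I_N+J)$ if and only if (a) $p^kN(\ker_{\mathbb Z}(M))\subseteq G$ for some $k\in\mathbb N$ (resp. $N(\ker_{\mathbb Z}(M))=G$), and (b) $\mathrm{rad}((\phi(I_M))^e,t_i)=\mathrm{rad}(\phi(f_1),\dots,\phi(f_s),t_i)$ for all $i=1,\dots,l$.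
   Context: $K$ is a field with algebraic closure $\bar K$; $I_M$ is the toric ideal of $M$ (kernel of $x_i\mapsto\mathbf t^{\mathbf a_i}$, $\mathbf a_i$ the columns of $M$). $\Gamma(N)=\{(\mathbf T^{\mathbf b_1},\dots,\mathbf T^{\mathbf b_n}):\mathbf T\in\bar K^l\}$, $V(I_N)$ the zero set of $I_N$ in $\bar K^n$. For a binomial $f=\mathbf x^{\mathbf u}-\mathbf x^{\mathbf v}$, $\widehat f=\mathbf u-\mathbf v\in\mathbb Z^n$. $\mathbf y_{\mathbf u}=\sum u_i\mathbf b_i$ and $N(\ker_{\mathbb Z}(M))=\{\mathbf y_{\mathbf u}:\mathbf u\in\mathbb Z^n, M\mathbf u^T=0\}$. $(\phi(I_M))^e=\phi(I_M)K[t_1,\dots,t_l]$. *)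

theory Defs
  imports "HOL-Library.Poly_Mapping" "HOL-Computational_Algebra.Polynomial"
begin

(* Multivariate polynomials over 'k in variables x_0, x_1, ... are represented as
  poly_mappings from exponent vectors (nat \<Rightarrow>\<^sub>0 nat) to coefficients; with the library
  instances this is a commutative ring. Laurent polynomials use (nat \<Rightarrow>\<^sub>0 int) exponents.
  Variable x_{i+1} of the paper is index i here (0-based). *)

type_synonym 'k mpoly = "(nat \<Rightarrow>\<^sub>0 nat) \<Rightarrow>\<^sub>0 'k"
type_synonym 'k lpoly = "(nat \<Rightarrow>\<^sub>0 int) \<Rightarrow>\<^sub>0 'k"

definition monom :: "(nat \<Rightarrow>\<^sub>0 nat) \<Rightarrow> 'k::comm_ring_1 mpoly" where
  "monom u = Poly_Mapping.single u 1"

definition var :: "nat \<Rightarrow> 'k::comm_ring_1 mpoly" where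
  "var i = monom (Poly_Mapping.single i 1)"

definition polys :: "nat \<Rightarrow> 'k::comm_ring_1 mpoly set" where
  "polys n = {p. \<forall>u\<in>Poly_Mapping.keys p. Poly_Mapping.keys u \<subseteq> {..<n}}"

definition ideal_span :: "'a::comm_ring_1 set \<Rightarrow> 'a set \<Rightarrow> 'a set" where
  "ideal_span R S = {(\<Sum>g\<in>F. c g * g) | F c. finite F \<and> F \<subseteq> S \<and> (\<forall>g\<in>F. c g \<in> R)}"

definition radical :: "'a::comm_ring_1 set \<Rightarrow> 'a set \<Rightarrow> 'a set" where
  "radical R I = {f \<in> R. \<exists>k. f ^ k \<in> I}"

definition mat_exp :: "(nat \<Rightarrow> nat \<Rightarrow> int) \<Rightarrow> nat \<Rightarrow> (nat \<Rightarrow>\<^sub>0 nat) \<Rightarrow> (nat \<Rightarrow>\<^sub>0 int)" where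
  "mat_exp M m u = Abs_poly_mapping (\<lambda>i. if i < m then (\<Sum>j\<in>Poly_Mapping.keys u. M i j * int (Poly_Mapping.lookup u j)) else 0)"

definition toric_map :: "(nat \<Rightarrow> nat \<Rightarrow> int) \<Rightarrow> nat \<Rightarrow> 'k::comm_ring_1 mpoly \<Rightarrow> 'k lpoly" where
  "toric_map M m p = (\<Sum>u\<in>Poly_Mapping.keys p. Poly_Mapping.single (mat_exp M m u) (Poly_Mapping.lookup p u))"

definition toric_ideal :: "(nat \<Rightarrow> nat \<Rightarrow> int) \<Rightarrow> nat \<Rightarrow> nat \<Rightarrow> 'k::comm_ring_1 mpoly set" where
  "toric_ideal M m n = {p \<in> polys n. toric_map M m p = 0}"

definition nat_mat_exp :: "(nat \<Rightarrow> nat \<Rightarrow> nat) \<Rightarrow> nat \<Rightarrow> (nat \<Rightarrow>\<^sub>0 nat) \<Rightarrow> (nat \<Rightarrow>\<^sub>0 nat)" where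
  "nat_mat_exp N l u = Abs_poly_mapping (\<lambda>i. if i < l then (\<Sum>j\<in>Poly_Mapping.keys u. N i j * Poly_Mapping.lookup u j) else 0)"

definition phi :: "(nat \<Rightarrow> nat \<Rightarrow> nat) \<Rightarrow> nat \<Rightarrow> 'k::comm_ring_1 mpoly \<Rightarrow> 'k mpoly" where
  "phi N l p = (\<Sum>u\<in>Poly_Mapping.keys p. Poly_Mapping.single (nat_mat_exp N l u) (Poly_Mapping.lookup p u))"

definition mpoly_eval :: "('k::comm_ring_1 \<Rightarrow> 'c::comm_ring_1) \<Rightarrow> 'k mpoly \<Rightarrow> (nat \<Rightarrow> 'c) \<Rightarrow> 'c" where
  "mpoly_eval emb p z = (\<Sum>u\<in>Poly_Mapping.keys p. emb (Poly_Mapping.lookup p u) * (\<Prod>i\<in>Poly_Mapping.keys u. z i ^ Poly_Mapping.lookup u i))"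

definition affine_space :: "nat \<Rightarrow> (nat \<Rightarrow> 'c::zero) set" where
  "affine_space n = {z. \<forall>j\<ge>n. z j = 0}"

definition zero_set :: "('k::comm_ring_1 \<Rightarrow> 'c::comm_ring_1) \<Rightarrow> nat \<Rightarrow> 'k mpoly set \<Rightarrow> (nat \<Rightarrow> 'c) set" where
  "zero_set emb n I = {z \<in> affine_space n. \<forall>p\<in>I. mpoly_eval emb p z = 0}"

definition Gamma :: "(nat \<Rightarrow> nat \<Rightarrow> nat) \<Rightarrow> nat \<Rightarrow> nat \<Rightarrow> (nat \<Rightarrow> 'c::comm_ring_1) set" where
  "Gamma N l n = {(\<lambda>j. if j < n then (\<Prod>i<l. T i ^ N i j) else 0) | T. T \<in> affine_space l}"

(* emb : K \<rightarrow> Kbar makes Kbar an algebraic closure of K (Kbar is algebraically closed by its sort). *)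
definition is_alg_closure :: "('k::field \<Rightarrow> 'c::alg_closed_field) \<Rightarrow> bool" where
  "is_alg_closure emb \<longleftrightarrow> inj emb \<and> emb 1 = 1 \<and>
     (\<forall>a b. emb (a + b) = emb a + emb b) \<and> (\<forall>a b. emb (a * b) = emb a * emb b) \<and>
     (\<forall>x. \<exists>q::'k poly. q \<noteq> 0 \<and> poly (map_poly emb q) x = 0)"

definition int_kernel :: "(nat \<Rightarrow> nat \<Rightarrow> int) \<Rightarrow> nat \<Rightarrow> nat \<Rightarrow> (nat \<Rightarrow> int) set" where
  "int_kernel M m n = {u. (\<forall>j\<ge>n. u j = 0) \<and> (\<forall>i<m. (\<Sum>j<n. M i j * u j) = 0)}"

definition yvec :: "(nat \<Rightarrow> nat \<Rightarrow> nat) \<Rightarrow> nat \<Rightarrow> nat \<Rightarrow> (nat \<Rightarrow> int) \<Rightarrow> (nat \<Rightarrow> int)" where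
  "yvec N l n u = (\<lambda>i. if i < l then (\<Sum>j<n. int (N i j) * u j) else 0)"

definition hat_exp :: "(nat \<Rightarrow>\<^sub>0 nat) \<Rightarrow> (nat \<Rightarrow>\<^sub>0 nat) \<Rightarrow> (nat \<Rightarrow> int)" where
  "hat_exp u v = (\<lambda>i. int (Poly_Mapping.lookup u i) - int (Poly_Mapping.lookup v i))"

definition int_span :: "nat \<Rightarrow> (nat \<Rightarrow> (nat \<Rightarrow> int)) \<Rightarrow> (nat \<Rightarrow> int) set" where
  "int_span s g = {(\<lambda>i. \<Sum>j<s. c j * g j i) | c. True}"

end

(* A prime P of K[x] containing I_N + J has as zero pattern a point of V(I_N) with entries in {0,1}.
  Since V(I_N) = Gamma(N), this pattern is cut out by the vanishing of the parameters t_i, i in E, for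
  some E. The differences N a - N b with x^a - x^b in P and x^a, x^b not in P form a lattice H
  containing every y_{f_j} for which the terms of f_j are not in P. Let x^u - x^v be a binomial of I_M
  whose terms are not both in P. By (a) if E is empty, and by (b) for some i in E otherwise,
  q (N u - N v) lies in H, where q = 1 or q is a power of the characteristic p; then
  (x^u - x^v)^q lies in P. As radicals are intersections of primes, this avoids the Nullstellensatz,
  and Gamma(N) = V(I_N) matters only for 0/1-points.
  Conversely, a power of each binomial of I_M lies in I_N + J. Applying phi gives (b). Passing to
  the group ring of Z^l / G gives (a): a difference g - h of group elements is nilpotent only if
  g = h (characteristic 0) or g/h has p-power order (characteristic p). *)

theory Submission
  imports Defs "HOL-Computational_Algebra.Primes"
begin

section \<open>Coefficient sums and exponent maps\<close>

lemma sum_keys_superset: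
  assumes "finite A" "Poly_Mapping.keys p \<subseteq> A" "\<And>u. a u 0 = 0"
  shows "(\<Sum>u\<in>Poly_Mapping.keys p. a u (Poly_Mapping.lookup p u)) = (\<Sum>u\<in>A. a u (Poly_Mapping.lookup p u))"
  by (rule sum.mono_neutral_left) (use assms in \<open>auto simp: in_keys_iff\<close>)

lemma poly_mapping_monomials:
  "p = (\<Sum>u\<in>Poly_Mapping.keys p. Poly_Mapping.single u (Poly_Mapping.lookup p u))"
proof (rule poly_mapping_eqI)
  fix k
  have "(\<Sum>u\<in>Poly_Mapping.keys p. Poly_Mapping.lookup (Poly_Mapping.single u (Poly_Mapping.lookup p u)) k)
      = (\<Sum>u\<in>Poly_Mapping.keys p. if u = k then Poly_Mapping.lookup p k else 0)"
    by (rule sum.cong) (auto simp: lookup_single)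
  then show "Poly_Mapping.lookup p k = Poly_Mapping.lookup (\<Sum>u\<in>Poly_Mapping.keys p. Poly_Mapping.single u (Poly_Mapping.lookup p u)) k"
    by (simp add: lookup_sum in_keys_iff)
qed

lemma poly_mapping_induct_add [case_names zero single add]:
  fixes p :: "'a \<Rightarrow>\<^sub>0 'b::comm_monoid_add"
  assumes "P 0" "\<And>u c. P (Poly_Mapping.single u c)" "\<And>p q. P p \<Longrightarrow> P q \<Longrightarrow> P (p + q)"
  shows "P p"
proof -
  have "P (\<Sum>u\<in>A. Poly_Mapping.single u (Poly_Mapping.lookup p u))" if "finite A" for A
    using that by (induction A) (auto intro: assms)
  from this[of "Poly_Mapping.keys p"] show ?thesis
    by (simp flip: poly_mapping_monomials)
qed

text \<open>The linear map of monoid algebras induced by a map of exponents. Both \<open>phi\<close>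
  and \<open>toric_map\<close> are instances, so one proof for additive \<open>h\<close> makes both
  multiplicative.\<close>

definition push :: "('a \<Rightarrow> 'b) \<Rightarrow> ('a \<Rightarrow>\<^sub>0 'k::comm_monoid_add) \<Rightarrow> ('b \<Rightarrow>\<^sub>0 'k)" where
  "push h p = (\<Sum>u\<in>Poly_Mapping.keys p. Poly_Mapping.single (h u) (Poly_Mapping.lookup p u))"

lemma phi_eq_push: "phi N l = push (nat_mat_exp N l)"
  by (simp add: fun_eq_iff phi_def push_def)

lemma toric_map_eq_push: "toric_map M m = push (mat_exp M m)"
  by (simp add: fun_eq_iff toric_map_def push_def)

lemma push_zero [simp]: "push h 0 = 0"
  by (simp add: push_def)

lemma push_single [simp]: "push h (Poly_Mapping.single u c) = Poly_Mapping.single (h u) c"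
  by (cases "c = 0") (simp_all add: push_def)

lemma push_add: "push h (p + q) = push h p + push h q"
  unfolding push_def by (rule setsum_keys_plus_distrib) (simp_all add: single_add)

lemma push_uminus: "push h (- p) = - push h (p :: _ \<Rightarrow>\<^sub>0 'k::ab_group_add)"
  using push_add[of h p "- p"] by (simp add: eq_neg_iff_add_eq_0 add.commute)

lemma push_diff: "push h (p - q) = push h p - push h (q :: _ \<Rightarrow>\<^sub>0 'k::ab_group_add)"
  using push_add[of h p "- q"] by (simp add: push_uminus)

lemma push_sum: "push h (sum p A) = (\<Sum>a\<in>A. push h (p a))"
  by (induction A rule: infinite_finite_induct) (simp_all add: push_add)

lemma push_mult:
  fixes p q :: "'a::comm_monoid_add \<Rightarrow>\<^sub>0 'k::comm_semiring_0"
  assumes "\<And>u v. h (u + v) = h u + (h v :: 'b::comm_monoid_add)"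
  shows "push h (p * q) = push h p * push h q"
proof (induction p rule: poly_mapping_induct_add)
  case (single u c)
  show ?case
    by (induction q rule: poly_mapping_induct_add)
       (simp_all add: mult_single assms distrib_left push_add)
qed (simp_all add: distrib_right push_add)

lemma push_power:
  fixes p :: "'a::comm_monoid_add \<Rightarrow>\<^sub>0 'k::comm_semiring_1"
  assumes "\<And>u v. h (u + v) = h u + (h v :: 'b::comm_monoid_add)" "h 0 = 0"
  shows "push h (p ^ k) = push h p ^ k"
proof (induction k)
  case 0
  have "push h (Poly_Mapping.single 0 (1::'k)) = Poly_Mapping.single 0 1"
    by (simp only: push_single assms(2))
  then show ?case by (simp del: push_single)
next
  case (Suc k)
  then show ?case by (simp only: power_Suc push_mult[of h, OF assms(1)])
qed

lemma push_monom: "push h (monom u) = monom (h u)"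
  by (simp add: monom_def)

text \<open>The coefficients of \<open>p\<close> over each fibre of \<open>h\<close> add up to 0. As
  \<open>g\<close> is constant on fibres within the support and \<open>a\<close> is additive in the
  coefficient, every fibre contributes 0. Below, \<open>a\<close> is a single-term polynomial or a
  term of an evaluation.\<close>

lemma push_eq_0_imp_sum_eq_0:
  fixes p :: "'a \<Rightarrow>\<^sub>0 'k::comm_monoid_add" and a :: "'c \<Rightarrow> 'k \<Rightarrow> 'd::comm_monoid_add"
  assumes "push h p = 0"
    and "\<And>w. a w 0 = 0" "\<And>w x y. a w (x + y) = a w x + a w y"
    and fac: "\<And>u v. u \<in> Poly_Mapping.keys p \<Longrightarrow> v \<in> Poly_Mapping.keys p \<Longrightarrow> h u = h v \<Longrightarrow> g u = g v"
  shows "(\<Sum>u\<in>Poly_Mapping.keys p. a (g u) (Poly_Mapping.lookup p u)) = 0"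
proof -
  let ?K = "Poly_Mapping.keys p"
  define r where "r w = (SOME v. v \<in> ?K \<and> h v = w)" for w
  have r: "r (h u) \<in> ?K \<and> h (r (h u)) = h u" if "u \<in> ?K" for u
    unfolding r_def by (rule someI[of _ u]) (use that in auto)
  have a_sum: "a w (sum x A) = (\<Sum>b\<in>A. a w (x b))" for w A and x :: "'a \<Rightarrow> 'k"
    by (induction A rule: infinite_finite_induct) (simp_all add: assms)
  have coeff: "(\<Sum>u\<in>{u\<in>?K. h u = w}. Poly_Mapping.lookup p u) = 0" for w
  proof -
    have "0 = Poly_Mapping.lookup (push h p) w" by (simp add: assms(1))
    also have "\<dots> = (\<Sum>u\<in>?K. if h u = w then Poly_Mapping.lookup p u else 0)"
      unfolding push_def lookup_sum by (rule sum.cong) (auto simp: lookup_single)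
    finally show ?thesis by (simp add: sum.inter_filter)
  qed
  have "(\<Sum>u\<in>?K. a (g u) (Poly_Mapping.lookup p u)) =
        (\<Sum>w\<in>h ` ?K. \<Sum>u\<in>{u\<in>?K. h u = w}. a (g u) (Poly_Mapping.lookup p u))"
    by (rule sum.image_gen) simp
  also have "\<dots> = (\<Sum>w\<in>h ` ?K. a (g (r w)) (\<Sum>u\<in>{u\<in>?K. h u = w}. Poly_Mapping.lookup p u))"
  proof (rule sum.cong[OF refl])
    fix w assume "w \<in> h ` ?K"
    have "g u = g (r w)" if "u \<in> ?K" "h u = w" for u
      using r[OF that(1)] that fac[of u "r w"] by auto
    then show "(\<Sum>u\<in>{u\<in>?K. h u = w}. a (g u) (Poly_Mapping.lookup p u)) =
        a (g (r w)) (\<Sum>u\<in>{u\<in>?K. h u = w}. Poly_Mapping.lookup p u)"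
      unfolding a_sum by (intro sum.cong) auto
  qed
  also have "\<dots> = 0" by (simp add: coeff assms)
  finally show ?thesis .
qed

section \<open>Exponent maps given by matrices\<close>

lemma lookup_mat_exp:
  assumes "finite A" "Poly_Mapping.keys u \<subseteq> A"
  shows "Poly_Mapping.lookup (mat_exp M m u) i =
     (if i < m then (\<Sum>j\<in>A. M i j * int (Poly_Mapping.lookup u j)) else 0)"
proof -
  have "finite {i. (if i < m then (\<Sum>j\<in>Poly_Mapping.keys u. M i j * int (Poly_Mapping.lookup u j)) else 0) \<noteq> 0}"
    by (rule finite_subset[of _ "{..<m}"]) (auto split: if_splits)
  then show ?thesis
    unfolding mat_exp_def
    by (simp add: sum_keys_superset[OF assms, of "\<lambda>j x. M i j * int x"])
qed

lemma lookup_nat_mat_exp: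
  assumes "finite A" "Poly_Mapping.keys u \<subseteq> A"
  shows "Poly_Mapping.lookup (nat_mat_exp N l u) i =
     (if i < l then (\<Sum>j\<in>A. N i j * Poly_Mapping.lookup u j) else 0)"
proof -
  have "finite {i. (if i < l then (\<Sum>j\<in>Poly_Mapping.keys u. N i j * Poly_Mapping.lookup u j) else 0) \<noteq> 0}"
    by (rule finite_subset[of _ "{..<l}"]) (auto split: if_splits)
  then show ?thesis
    unfolding nat_mat_exp_def
    by (simp add: sum_keys_superset[OF assms, of "\<lambda>j x. N i j * x"])
qed

lemma mat_exp_add: "mat_exp M m (u + v) = mat_exp M m u + mat_exp M m v"
proof (rule poly_mapping_eqI)
  \<comment> \<open>All three exponent vectors are expanded over one index set, since the support of
    a sum differs from those of the summands.\<close>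
  let ?A = "Poly_Mapping.keys u \<union> Poly_Mapping.keys v"
  fix i
  have "Poly_Mapping.keys (u + v) \<subseteq> ?A" by (rule keys_add)
  then show "Poly_Mapping.lookup (mat_exp M m (u + v)) i = Poly_Mapping.lookup (mat_exp M m u + mat_exp M m v) i"
    by (simp add: lookup_mat_exp[of ?A] lookup_add distrib_left sum.distrib)
qed

lemma nat_mat_exp_add: "nat_mat_exp N l (u + v) = nat_mat_exp N l u + nat_mat_exp N l v"
proof (rule poly_mapping_eqI)
  let ?A = "Poly_Mapping.keys u \<union> Poly_Mapping.keys v"
  fix i
  have "Poly_Mapping.keys (u + v) \<subseteq> ?A" by (rule keys_add)
  then show "Poly_Mapping.lookup (nat_mat_exp N l (u + v)) i = Poly_Mapping.lookup (nat_mat_exp N l u + nat_mat_exp N l v) i"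
    by (simp add: lookup_nat_mat_exp[of ?A] lookup_add distrib_left sum.distrib)
qed

lemma mat_exp_zero [simp]: "mat_exp M m 0 = 0"
  using mat_exp_add[of M m 0 0] by simp

lemma nat_mat_exp_zero [simp]: "nat_mat_exp N l 0 = 0"
  using nat_mat_exp_add[of N l 0 0] by simp

lemma keys_nat_mat_exp: "Poly_Mapping.keys (nat_mat_exp N l u) \<subseteq> {..<l}"
  by (auto simp: in_keys_iff lookup_nat_mat_exp[OF finite_keys subset_refl] split: if_splits)

lemma lookup_mat_exp_int:
  "Poly_Mapping.lookup (mat_exp (\<lambda>i j. int (N i j)) l u) i = int (Poly_Mapping.lookup (nat_mat_exp N l u) i)"
  by (simp add: lookup_mat_exp[OF finite_keys subset_refl] lookup_nat_mat_exp[OF finite_keys subset_refl])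

lemma mat_exp_int_eq_iff:
  "mat_exp (\<lambda>i j. int (N i j)) l u = mat_exp (\<lambda>i j. int (N i j)) l v \<longleftrightarrow> nat_mat_exp N l u = nat_mat_exp N l v"
  by (simp add: poly_mapping_eq_iff fun_eq_iff lookup_mat_exp_int)

text \<open>The vector N u is the same whether read with natural or integer entries, so both
  exponent maps have the same fibres. Hence I_N lies in the kernel of \<open>phi\<close>.\<close>

lemma phi_eq_0_if_toric:
  assumes "toric_map (\<lambda>i j. int (N i j)) l p = 0"
  shows "phi N l p = 0"
  using push_eq_0_imp_sum_eq_0[of "mat_exp (\<lambda>i j. int (N i j)) l" p Poly_Mapping.single "nat_mat_exp N l"] assms
  by (simp add: phi_def toric_map_eq_push single_add mat_exp_int_eq_iff)

lemmas phi_simps = phi_eq_push push_mult[of "nat_mat_exp N l" for N l, OF nat_mat_exp_add]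
  push_power[of "nat_mat_exp N l" for N l, OF nat_mat_exp_add nat_mat_exp_zero]
  push_diff push_sum push_monom

lemmas toric_map_simps = toric_map_eq_push push_mult[of "mat_exp M m" for M m, OF mat_exp_add]
  push_power[of "mat_exp M m" for M m, OF mat_exp_add mat_exp_zero]
  push_diff push_sum push_monom

lemma monom_mult: "monom u * monom v = monom (u + v)"
  by (simp add: monom_def mult_single)

definition exp_scale :: "nat \<Rightarrow> ('a \<Rightarrow>\<^sub>0 nat) \<Rightarrow> ('a \<Rightarrow>\<^sub>0 nat)" where
  "exp_scale k u = Poly_Mapping.map ((*) k) u"

lemma lookup_exp_scale [simp]: "Poly_Mapping.lookup (exp_scale k u) i = k * Poly_Mapping.lookup u i"
  by (simp add: exp_scale_def map.rep_eq "when_def")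

lemma keys_exp_scale: "Poly_Mapping.keys (exp_scale k u) \<subseteq> Poly_Mapping.keys u"
  by (auto simp: in_keys_iff)

lemma monom_power: "monom u ^ k = monom (exp_scale k u)"
proof (induction k)
  case 0
  have "exp_scale 0 u = 0" by (rule poly_mapping_eqI) simp
  then show ?case by (simp add: monom_def)
next
  case (Suc k)
  have "u + exp_scale k u = exp_scale (Suc k) u" by (rule poly_mapping_eqI) (simp add: lookup_add)
  then show ?case by (simp add: Suc monom_mult)
qed

lemma monom_0: "monom 0 = 1"
  by (simp add: monom_def)

section \<open>Prime ideals over a subring\<close>

definition is_subring :: "'a::comm_ring_1 set \<Rightarrow> bool" where
  "is_subring R \<longleftrightarrow> 1 \<in> R \<and> (\<forall>a\<in>R. \<forall>b\<in>R. a - b \<in> R \<and> a * b \<in> R)"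

text \<open>Ideals are not required to lie in \<^term>\<open>R\<close>, so that an ideal of the ambient ring
  is also an ideal over every subring.\<close>
definition ideal_over :: "'a::comm_ring_1 set \<Rightarrow> 'a set \<Rightarrow> bool" where
  "ideal_over R I \<longleftrightarrow> 0 \<in> I \<and> (\<forall>a\<in>I. \<forall>b\<in>I. a + b \<in> I) \<and> (\<forall>r\<in>R. \<forall>a\<in>I. r * a \<in> I)"

definition prime_over :: "'a::comm_ring_1 set \<Rightarrow> 'a set \<Rightarrow> bool" where
  "prime_over R P \<longleftrightarrow> P \<subseteq> R \<and> ideal_over R P \<and> 1 \<notin> P \<and>
     (\<forall>a\<in>R. \<forall>b\<in>R. a * b \<in> P \<longrightarrow> a \<in> P \<or> b \<in> P)"

lemma is_subring_0: "is_subring R \<Longrightarrow> 0 \<in> R"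
  unfolding is_subring_def by (metis diff_self)

lemma is_subring_uminus: "is_subring R \<Longrightarrow> a \<in> R \<Longrightarrow> - a \<in> R"
  unfolding is_subring_def by (metis diff_self diff_0)

lemma is_subring_add: "is_subring R \<Longrightarrow> a \<in> R \<Longrightarrow> b \<in> R \<Longrightarrow> a + b \<in> R"
  using is_subring_uminus[of R b] unfolding is_subring_def by (metis diff_minus_eq_add)

lemma is_subring_mult: "is_subring R \<Longrightarrow> a \<in> R \<Longrightarrow> b \<in> R \<Longrightarrow> a * b \<in> R"
  unfolding is_subring_def by blast

lemma is_subring_power: "is_subring R \<Longrightarrow> a \<in> R \<Longrightarrow> a ^ k \<in> R"
  by (induction k) (auto simp: is_subring_def)

lemma ideal_over_add: "ideal_over R I \<Longrightarrow> a \<in> I \<Longrightarrow> b \<in> I \<Longrightarrow> a + b \<in> I"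
  by (simp add: ideal_over_def)

lemma ideal_over_mult: "ideal_over R I \<Longrightarrow> r \<in> R \<Longrightarrow> a \<in> I \<Longrightarrow> r * a \<in> I"
  by (simp add: ideal_over_def)

lemma ideal_over_sum: "ideal_over R I \<Longrightarrow> (\<And>x. x \<in> A \<Longrightarrow> g x \<in> I) \<Longrightarrow> sum g A \<in> I"
  by (induction A rule: infinite_finite_induct) (auto simp: ideal_over_def)

lemma ideal_over_diff:
  assumes "is_subring R" "ideal_over R I" "a \<in> I" "b \<in> I"
  shows "a - b \<in> I"
proof -
  have "- 1 \<in> R" using assms(1) is_subring_uminus[of R 1] by (simp add: is_subring_def)
  then have "(- 1) * b \<in> I" using assms by (intro ideal_over_mult)
  then have "a + (- 1) * b \<in> I" using assms by (intro ideal_over_add)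
  then show ?thesis by simp
qed

lemma ideal_span_minimal:
  assumes "ideal_over R I" "S \<subseteq> I"
  shows "ideal_span R S \<subseteq> I"
proof
  fix x assume "x \<in> ideal_span R S"
  then obtain F c where "x = (\<Sum>g\<in>F. c g * g)" "F \<subseteq> S" "\<forall>g\<in>F. c g \<in> R"
    by (auto simp: ideal_span_def)
  then show "x \<in> I" using assms by (auto intro!: ideal_over_sum ideal_over_mult)
qed

lemma ideal_span_superset:
  assumes "is_subring R"
  shows "S \<subseteq> ideal_span R S"
proof
  fix x assume "x \<in> S"
  then show "x \<in> ideal_span R S"
    unfolding ideal_span_def
    by (intro CollectI exI[of _ "{x}"] exI[of _ "\<lambda>_. 1"]) (use assms in \<open>auto simp: is_subring_def\<close>)
qed

lemma ideal_over_ideal_span: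
  assumes R: "is_subring R"
  shows "ideal_over R (ideal_span R S)"
  unfolding ideal_over_def
proof (intro conjI ballI)
  show "0 \<in> ideal_span R S"
    unfolding ideal_span_def by (intro CollectI exI[of _ "{}"]) auto
next
  fix a b assume "a \<in> ideal_span R S" "b \<in> ideal_span R S"
  then obtain F c G d where a: "a = (\<Sum>g\<in>F. c g * g)" "finite F" "F \<subseteq> S" "\<forall>g\<in>F. c g \<in> R"
    and b: "b = (\<Sum>g\<in>G. d g * g)" "finite G" "G \<subseteq> S" "\<forall>g\<in>G. d g \<in> R"
    unfolding ideal_span_def by blast
  \<comment> \<open>The two finite sets of generators may overlap, so both coefficient families are
    extended by 0 to the union and added there.\<close>
  let ?e = "\<lambda>g. (if g \<in> F then c g else 0) + (if g \<in> G then d g else 0)"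
  have "a = (\<Sum>g\<in>F \<union> G. (if g \<in> F then c g else 0) * g)"
    unfolding a(1) by (rule sum.mono_neutral_cong_left) (use a b in auto)
  moreover have "b = (\<Sum>g\<in>F \<union> G. (if g \<in> G then d g else 0) * g)"
    unfolding b(1) by (rule sum.mono_neutral_cong_left) (use a b in auto)
  ultimately have "a + b = (\<Sum>g\<in>F \<union> G. ?e g * g)"
    by (simp add: distrib_right sum.distrib)
  moreover have "\<forall>g\<in>F \<union> G. ?e g \<in> R"
    using a(4) b(4) R by (auto intro: is_subring_add is_subring_0)
  ultimately show "a + b \<in> ideal_span R S"
    using a b unfolding ideal_span_def by (intro CollectI exI[of _ "F \<union> G"] exI[of _ ?e]) auto
next
  fix r a assume "r \<in> R" "a \<in> ideal_span R S"
  then obtain F c where a: "a = (\<Sum>g\<in>F. c g * g)" "finite F" "F \<subseteq> S" "\<forall>g\<in>F. c g \<in> R"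
    unfolding ideal_span_def by blast
  then show "r * a \<in> ideal_span R S" using R \<open>r \<in> R\<close>
    unfolding ideal_span_def
    by (intro CollectI exI[of _ F] exI[of _ "\<lambda>g. r * c g"])
       (auto simp: sum_distrib_left mult.assoc is_subring_mult)
qed

lemma ideal_span_subset_subring:
  assumes "is_subring R" "S \<subseteq> R"
  shows "ideal_span R S \<subseteq> R"
  by (rule ideal_span_minimal)
     (use assms in \<open>auto simp: ideal_over_def is_subring_0 is_subring_add is_subring_mult\<close>)

lemma prime_over_power:
  assumes "is_subring R" "prime_over R P" "a \<in> R" "a ^ k \<in> P"
  shows "a \<in> P"
  using assms(4)
proof (induction k)
  case (Suc k)
  then show ?case
    using assms is_subring_power[OF assms(1,3), of k] by (auto simp: prime_over_def)
qed (use assms in \<open>auto simp: prime_over_def\<close>)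

text \<open>Zorn's lemma gives an ideal maximal among those that contain \<open>I\<close> and no
  power of \<open>f\<close>. It is prime, because adjoining any further element of \<open>R\<close>
  brings in a power of \<open>f\<close>.\<close>

lemma exists_prime_over_avoiding_powers:
  assumes R: "is_subring R" and I: "ideal_over R I" "I \<subseteq> R" and f: "f \<in> R" "\<And>k. f ^ k \<notin> I"
  obtains P where "prime_over R P" "I \<subseteq> P" "f \<notin> P"
proof -
  define A where "A = {J. I \<subseteq> J \<and> J \<subseteq> R \<and> ideal_over R J \<and> (\<forall>k. f ^ k \<notin> J)}"
  have "\<exists>P\<in>A. \<forall>X\<in>A. P \<subseteq> X \<longrightarrow> X = P"
  proof (rule subset_Zorn_nonempty)
    show "A \<noteq> {}" using I f by (auto simp: A_def)
  next
    fix C assume C: "C \<noteq> {}" "subset.chain A C"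
    then have "C \<subseteq> A" and lin: "\<And>X Y. X \<in> C \<Longrightarrow> Y \<in> C \<Longrightarrow> X \<subseteq> Y \<or> Y \<subseteq> X"
      by (auto simp: subset_chain_def)
    have "a + b \<in> \<Union>C" if ab: "a \<in> \<Union>C" "b \<in> \<Union>C" for a b
    proof -
      obtain X Y where XY: "X \<in> C" "a \<in> X" "Y \<in> C" "b \<in> Y" using ab by blast
      obtain Z where "Z \<in> C" "a \<in> Z" "b \<in> Z" using lin[OF XY(1,3)] XY by blast
      moreover from this have "ideal_over R Z" using \<open>C \<subseteq> A\<close> by (auto simp: A_def)
      ultimately show ?thesis by (blast intro: ideal_over_add)
    qed
    then have "ideal_over R (\<Union>C)"
      using C(1) \<open>C \<subseteq> A\<close> unfolding ideal_over_def A_def by blast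
    then show "\<Union>C \<in> A" using C(1) \<open>C \<subseteq> A\<close> unfolding A_def by blast
  qed
  then obtain P where P: "P \<in> A" and max: "\<And>X. X \<in> A \<Longrightarrow> P \<subseteq> X \<Longrightarrow> X = P" by blast
  have iP: "ideal_over R P" and PR: "P \<subseteq> R" and fP: "\<And>k. f ^ k \<notin> P" and IP: "I \<subseteq> P"
    using P by (auto simp: A_def)
  have meets: "\<exists>k p r. f ^ k = p + r * a \<and> p \<in> P \<and> r \<in> R" if a: "a \<in> R" "a \<notin> P" for a
  proof (rule ccontr)
    assume none: "\<not> ?thesis"
    define J where "J = {p + r * a |p r. p \<in> P \<and> r \<in> R}"
    have memJ: "p + r * a \<in> J" if "p \<in> P" "r \<in> R" for p r
      using that by (auto simp: J_def)
    have P0: "0 \<in> P" using iP by (simp add: ideal_over_def)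
    have PJ: "P \<subseteq> J" using memJ[OF _ is_subring_0[OF R]] by auto
    have "ideal_over R J" unfolding ideal_over_def
    proof (intro conjI ballI)
      show "0 \<in> J" using PJ P0 by auto
    next
      fix x y assume "x \<in> J" "y \<in> J"
      then obtain p r p' r' where "x = p + r * a" "y = p' + r' * a" "p \<in> P" "p' \<in> P" "r \<in> R" "r' \<in> R"
        unfolding J_def by blast
      then show "x + y \<in> J"
        using memJ[of "p + p'" "r + r'"] ideal_over_add[OF iP] is_subring_add[OF R]
        by (simp add: algebra_simps)
    next
      fix s x assume "s \<in> R" "x \<in> J"
      then obtain p r where "x = p + r * a" "p \<in> P" "r \<in> R" unfolding J_def by blast
      then have "s * p + s * r * a \<in> J"
        using \<open>s \<in> R\<close> by (intro memJ ideal_over_mult[OF iP] is_subring_mult[OF R])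
      then show "s * x \<in> J" by (simp add: \<open>x = p + r * a\<close> algebra_simps)
    qed
    moreover have "J \<subseteq> R"
      using PR R a unfolding J_def by (auto intro!: is_subring_add is_subring_mult)
    moreover have "f ^ k \<notin> J" for k using none by (auto simp: J_def)
    ultimately have "J \<in> A" using PJ IP by (auto simp: A_def)
    then have "J = P" using max PJ by blast
    moreover have "a \<in> J" using memJ[OF P0, of 1] R by (simp add: is_subring_def)
    ultimately show False using a by simp
  qed
  have "a \<in> P \<or> b \<in> P" if ab: "a \<in> R" "b \<in> R" "a * b \<in> P" for a b
  proof (rule ccontr)
    assume "\<not> ?thesis"
    then obtain i p r j p' r' where 1: "f ^ i = p + r * a" "p \<in> P" "r \<in> R"
      and 2: "f ^ j = p' + r' * b" "p' \<in> P" "r' \<in> R"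
      using meets ab by blast
    \<comment> \<open>In the product of the two powers, every summand contains p, p' or a * b as a
      factor.\<close>
    have "f ^ (i + j) = f ^ j * p + (r * a * p' + r * r' * (a * b))"
      by (simp add: power_add 1 2 algebra_simps)
    moreover have "f ^ j * p \<in> P" "r * a * p' \<in> P" "r * r' * (a * b) \<in> P"
      using is_subring_power[OF R f(1)] 1(2,3) 2(2,3) ab R
      by (auto intro!: ideal_over_mult[OF iP] is_subring_mult simp del: 1 2)
    ultimately have "f ^ (i + j) \<in> P" by (simp add: ideal_over_add[OF iP])
    then show False using fP by blast
  qed
  then have "prime_over R P"
    using iP PR fP[of 0] unfolding prime_over_def by auto
  then show thesis using that IP fP[of 1] by simp
qed

text \<open>Membership in a prime ignores exponents, so powers of different generators never have to
  be combined by hand. It serves in K[x] for one direction of the theorem and in K[t] for the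
  other.\<close>

lemma in_radical_if_in_primes:
  assumes "is_subring R" "ideal_over R I" "I \<subseteq> R" "f \<in> R"
    and "\<And>P. prime_over R P \<Longrightarrow> I \<subseteq> P \<Longrightarrow> f \<in> P"
  shows "f \<in> radical R I"
  using exists_prime_over_avoiding_powers[OF assms(1-4)] assms(4,5)
  unfolding radical_def by blast

section \<open>Polynomials in finitely many variables as a subring\<close>

lemma keys_add_nat: "Poly_Mapping.keys (u + v :: _ \<Rightarrow>\<^sub>0 nat) = Poly_Mapping.keys u \<union> Poly_Mapping.keys v"
  by (auto simp: in_keys_iff lookup_add)

lemma is_subring_polys: "is_subring (polys n :: 'k::comm_ring_1 mpoly set)"
  unfolding is_subring_def
proof (intro conjI ballI)
  show "1 \<in> (polys n :: 'k mpoly set)" by (simp add: polys_def)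
next
  fix a b :: "'k mpoly" assume "a \<in> polys n" "b \<in> polys n"
  then show "a - b \<in> polys n" "a * b \<in> polys n"
    using keys_diff[of a b] keys_mult[of a b]
    by (fastforce simp: polys_def keys_add_nat)+
qed

lemma monom_in_polys: "Poly_Mapping.keys u \<subseteq> {..<n} \<Longrightarrow> monom u \<in> polys n"
  by (simp add: polys_def monom_def)

lemma var_in_polys: "i < n \<Longrightarrow> var i \<in> polys n"
  by (simp add: var_def monom_in_polys)

lemma phi_in_polys: "phi N l p \<in> polys l"
proof -
  have "phi N l p = (\<Sum>u\<in>Poly_Mapping.keys p. Poly_Mapping.single (nat_mat_exp N l u) (Poly_Mapping.lookup p u))"
    by (simp add: phi_def)
  also have "\<dots> \<in> polys l"
  proof (rule ideal_over_sum[of "{}"])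
    show "ideal_over {} (polys l)"
      using is_subring_0[OF is_subring_polys] is_subring_add[OF is_subring_polys]
      by (auto simp: ideal_over_def)
    show "Poly_Mapping.single (nat_mat_exp N l u) (Poly_Mapping.lookup p u) \<in> polys l" for u
      using keys_nat_mat_exp by (auto simp: polys_def)
  qed
  finally show ?thesis .
qed

section \<open>Lattices and powers of binomials\<close>

text \<open>The multipliers that enter (a). Allowing only 1 in characteristic 0 and the powers of p
  otherwise gives both cases of the theorem one formulation, and taking such powers is
  additive.\<close>

definition frob_exp :: "'k::comm_ring_1 itself \<Rightarrow> nat \<Rightarrow> bool" where
  "frob_exp _ q \<longleftrightarrow> (if CHAR('k) = 0 then q = 1 else \<exists>e. q = CHAR('k) ^ e)"

lemma CHAR_mpoly: "CHAR('k::comm_ring_1 mpoly) = CHAR('k)"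
proof (rule CHAR_eqI)
  have of_nat_mpoly: "(of_nat c :: 'k mpoly) = Poly_Mapping.single 0 (of_nat c)" for c
    by simp
  show "of_nat CHAR('k) = (0 :: 'k mpoly)"
    unfolding of_nat_mpoly by (simp del: single_of_nat)
  show "CHAR('k) dvd x" if "of_nat x = (0 :: 'k mpoly)" for x
  proof -
    have "Poly_Mapping.lookup (Poly_Mapping.single 0 (of_nat x) :: 'k mpoly) 0 = 0"
      unfolding of_nat_mpoly[symmetric] using that by simp
    then show ?thesis by (simp only: lookup_single_eq of_nat_eq_0_iff_char_dvd)
  qed
qed

lemma frob_diff:
  fixes x y :: "'k::field mpoly"
  assumes "frob_exp TYPE('k) q"
  shows "(x - y) ^ q = x ^ q - y ^ q"
proof (cases "CHAR('k) = 0")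
  case False
  then obtain e where "q = CHAR('k mpoly) ^ e"
    using assms by (auto simp: frob_exp_def CHAR_mpoly)
  moreover have "prime CHAR('k mpoly)"
    using False by (simp add: CHAR_mpoly prime_CHAR_semidom)
  \<comment> \<open>Additivity is applied to (x - y) + y, which spares a discussion of the sign of
    (- y) ^ q.\<close>
  ultimately have "((x - y) + y) ^ q = (x - y) ^ q + y ^ q"
    using freshmans_dream' by blast
  then show ?thesis by simp
qed (use assms in \<open>simp add: frob_exp_def\<close>)

section \<open>Subgroups of integer vectors\<close>

definition int_subgroup :: "('a \<Rightarrow> int) set \<Rightarrow> bool" where
  "int_subgroup H \<longleftrightarrow> (\<lambda>_. 0) \<in> H \<and> (\<forall>a\<in>H. \<forall>b\<in>H. (\<lambda>i. a i - b i) \<in> H)"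

lemma int_subgroup_0: "int_subgroup H \<Longrightarrow> (\<lambda>_. 0) \<in> H"
  by (simp add: int_subgroup_def)

lemma int_subgroup_diff: "int_subgroup H \<Longrightarrow> a \<in> H \<Longrightarrow> b \<in> H \<Longrightarrow> (\<lambda>i. a i - b i) \<in> H"
  by (simp add: int_subgroup_def)

lemma int_subgroup_uminus: "int_subgroup H \<Longrightarrow> a \<in> H \<Longrightarrow> (\<lambda>i. - a i) \<in> H"
  using int_subgroup_diff[of H "\<lambda>_. 0" a] int_subgroup_0[of H] by simp

lemma int_subgroup_add: "int_subgroup H \<Longrightarrow> a \<in> H \<Longrightarrow> b \<in> H \<Longrightarrow> (\<lambda>i. a i + b i) \<in> H"
  using int_subgroup_diff[of H a "\<lambda>i. - b i"] int_subgroup_uminus[of H b] by simp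

lemma int_subgroup_uminus_iff: "int_subgroup H \<Longrightarrow> (\<lambda>i. - a i) \<in> H \<longleftrightarrow> a \<in> H"
  using int_subgroup_uminus[of H a] int_subgroup_uminus[of H "\<lambda>i. - a i"] by auto

lemma int_subgroup_scale:
  assumes H: "int_subgroup H" and "a \<in> H"
  shows "(\<lambda>i. c * a i) \<in> H"
proof -
  have nat: "(\<lambda>i. int k * a i) \<in> H" for k
  proof (induction k)
    case (Suc k)
    have "(\<lambda>i. a i + int k * a i) \<in> H" by (rule int_subgroup_add[OF H assms(2) Suc])
    then show ?case by (simp add: distrib_right)
  qed (use H in \<open>simp add: int_subgroup_0\<close>)
  show ?thesis
  proof (cases "c \<ge> 0")
    case True
    then show ?thesis using nat[of "nat c"] by simp
  next
    case False
    then show ?thesis using int_subgroup_uminus[OF H nat[of "nat (- c)"]] by simp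
  qed
qed

lemma int_subgroup_int_span: "int_subgroup (int_span s g)"
  unfolding int_subgroup_def int_span_def
proof (intro conjI ballI)
  show "(\<lambda>_. 0) \<in> {\<lambda>i. \<Sum>j<s. c j * g j i |c. True}"
    by (intro CollectI exI[of _ "\<lambda>_. 0"]) simp
  fix a b assume "a \<in> {\<lambda>i. \<Sum>j<s. c j * g j i |c. True}" "b \<in> {\<lambda>i. \<Sum>j<s. c j * g j i |c. True}"
  then obtain c d where "a = (\<lambda>i. \<Sum>j<s. c j * g j i)" "b = (\<lambda>i. \<Sum>j<s. d j * g j i)" by blast
  then show "(\<lambda>i. a i - b i) \<in> {\<lambda>i. \<Sum>j<s. c j * g j i |c. True}"
    by (intro CollectI exI[of _ "\<lambda>j. c j - d j"]) (simp add: left_diff_distrib sum_subtractf)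
qed

lemma int_span_minimal:
  assumes H: "int_subgroup H" and g: "\<And>j. j < s \<Longrightarrow> g j \<in> H"
  shows "int_span s g \<subseteq> H"
proof
  fix y assume "y \<in> int_span s g"
  then obtain c where y: "y = (\<lambda>i. \<Sum>j<s. c j * g j i)" by (auto simp: int_span_def)
  have "(\<lambda>i. \<Sum>j<t. c j * g j i) \<in> H" if "t \<le> s" for t
    using that
  proof (induction t)
    case (Suc t)
    then show ?case
      using int_subgroup_add[OF H, of "\<lambda>i. \<Sum>j<t. c j * g j i" "\<lambda>i. c t * g t i"]
      by (simp add: int_subgroup_scale[OF H g])
  qed (use H in \<open>simp add: int_subgroup_0\<close>)
  then show "y \<in> H" using y by blast
qed

lemma int_span_gen:
  assumes "j < s" shows "g j \<in> int_span s g"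
proof -
  have "(\<Sum>j'<s. (if j' = j then 1 else 0) * g j' i) = (\<Sum>j'<s. if j' = j then g j i else 0)" for i
    by (rule sum.cong) auto
  then have "g j = (\<lambda>i. \<Sum>j'<s. (if j' = j then 1 else 0) * g j' i)"
    using assms by simp
  then show ?thesis unfolding int_span_def by (intro CollectI exI conjI) auto
qed

text \<open>This makes the exponent \<open>k\<close> in (a) uniform.\<close>
lemma int_subgroup_chain_stationary:
  fixes K :: "(nat \<Rightarrow> int) set" and Q :: "nat \<Rightarrow> (nat \<Rightarrow> int) set"
  assumes "int_subgroup K" "\<And>u j. u \<in> K \<Longrightarrow> n \<le> j \<Longrightarrow> u j = 0"
    and Q: "\<And>k. int_subgroup (Q k)" "\<And>k. Q k \<subseteq> Q (Suc k)" and "K \<subseteq> (\<Union>k. Q k)"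
  shows "\<exists>k. K \<subseteq> Q k"
  using assms(1,2,5)
proof (induction n arbitrary: K)
  case 0
  then have "u = (\<lambda>_. 0)" if "u \<in> K" for u using that by (simp add: fun_eq_iff)
  then show ?case using int_subgroup_0[OF Q(1)] by blast
next
  case (Suc n)
  have mono: "Q i \<subseteq> Q j" if "i \<le> j" for i j
    using lift_Suc_mono_le[of Q] Q(2) that by blast
  \<comment> \<open>The vectors whose last coordinate vanishes fall under the induction hypothesis.
    The others will differ from them by multiples of one vector \<open>u0\<close>.\<close>
  define K0 where "K0 = {u \<in> K. u n = 0}"
  have "int_subgroup K0"
    using Suc.prems(1) by (auto simp: int_subgroup_def K0_def)
  moreover have "u j = 0" if "u \<in> K0" "n \<le> j" for u j
    using that Suc.prems(2)[of u j] by (cases "j = n") (auto simp: K0_def)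
  moreover have "K0 \<subseteq> (\<Union>k. Q k)" using Suc.prems(3) by (auto simp: K0_def)
  ultimately obtain k0 where k0: "K0 \<subseteq> Q k0" using Suc.IH by blast
  show ?case
  proof (cases "K0 = K")
    case False
    then obtain u1 where "u1 \<in> K" "u1 n \<noteq> 0" by (auto simp: K0_def)
    \<comment> \<open>By division with remainder, the least nonzero absolute value of a last
      coordinate divides all last coordinates on \<open>K\<close>. A multiple of \<open>u0\<close>
      therefore moves each vector of \<open>K\<close> into \<open>K0\<close>.\<close>
    define d where "d = (LEAST d. \<exists>u\<in>K. u n \<noteq> 0 \<and> nat \<bar>u n\<bar> = d)"
    have "\<exists>d. \<exists>u\<in>K. u n \<noteq> 0 \<and> nat \<bar>u n\<bar> = d" using \<open>u1 \<in> K\<close> \<open>u1 n \<noteq> 0\<close> by blast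
    then have "\<exists>u\<in>K. u n \<noteq> 0 \<and> nat \<bar>u n\<bar> = d" unfolding d_def by (rule LeastI_ex)
    then obtain u0 where u0: "u0 \<in> K" "u0 n \<noteq> 0" "nat \<bar>u0 n\<bar> = d" by blast
    obtain k1 where k1: "u0 \<in> Q k1" using Suc.prems(3) u0 by blast
    have "u \<in> Q (max k0 k1)" if u: "u \<in> K" for u
    proof -
      define c where "c = u n div u0 n"
      define v where "v = (\<lambda>i. u i - c * u0 i)"
      have "v \<in> K" unfolding v_def
        by (intro int_subgroup_diff[OF Suc.prems(1)] int_subgroup_scale[OF Suc.prems(1)] u u0)
      moreover have vn: "v n = u n mod u0 n" by (simp add: v_def c_def minus_div_mult_eq_mod)
      ultimately have "v n \<noteq> 0 \<Longrightarrow> d \<le> nat \<bar>v n\<bar>" unfolding d_def by (intro Least_le) blast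
      moreover have "nat \<bar>v n\<bar> < d" using u0 abs_mod_less[of "u0 n" "u n"] vn by simp
      ultimately have "v n = 0" by linarith
      then have "v \<in> Q (max k0 k1)" using \<open>v \<in> K\<close> k0 mono[of k0 "max k0 k1"] by (auto simp: K0_def)
      moreover have "u0 \<in> Q (max k0 k1)" using k1 mono[of k1 "max k0 k1"] by auto
      ultimately have "(\<lambda>i. v i + c * u0 i) \<in> Q (max k0 k1)"
        by (intro int_subgroup_add int_subgroup_scale Q)
      then show ?thesis by (simp add: v_def)
    qed
    then show ?thesis by blast
  qed (use k0 in blast)
qed

section \<open>Coset functionals and the ideals they cut out\<close>

text \<open>The common kernel of these functionals, over all \<open>\<gamma>\<close>, is the kernel of the map that kills the
  variables in \<open>E\<close> and then passes to the group ring of the quotient by \<open>H\<close>.\<close>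
definition coset_coeff :: "nat set \<Rightarrow> (nat \<Rightarrow> int) set \<Rightarrow> (nat \<Rightarrow> int) \<Rightarrow> 'k::comm_ring_1 mpoly \<Rightarrow> 'k" where
  "coset_coeff E H \<gamma> p = (\<Sum>\<alpha>\<in>Poly_Mapping.keys p.
     (if Poly_Mapping.keys \<alpha> \<inter> E = {} \<and> (\<lambda>i. int (Poly_Mapping.lookup \<alpha> i) - \<gamma> i) \<in> H then Poly_Mapping.lookup p \<alpha> else 0))"

definition coset_ideal :: "nat set \<Rightarrow> (nat \<Rightarrow> int) set \<Rightarrow> 'k::comm_ring_1 mpoly set" where
  "coset_ideal E H = {p. \<forall>\<gamma>. coset_coeff E H \<gamma> p = 0}"

lemma coset_coeff_0 [simp]: "coset_coeff E H \<gamma> 0 = 0"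
  by (simp add: coset_coeff_def)

lemma coset_coeff_add: "coset_coeff E H \<gamma> (p + q) = coset_coeff E H \<gamma> p + coset_coeff E H \<gamma> q"
  unfolding coset_coeff_def by (rule setsum_keys_plus_distrib) auto

lemma coset_coeff_diff: "coset_coeff E H \<gamma> (p - q) = coset_coeff E H \<gamma> p - coset_coeff E H \<gamma> q"
  using coset_coeff_add[of E H \<gamma> "p - q" q] by simp

lemma coset_coeff_single: "coset_coeff E H \<gamma> (Poly_Mapping.single \<alpha> c) =
   (if Poly_Mapping.keys \<alpha> \<inter> E = {} \<and> (\<lambda>i. int (Poly_Mapping.lookup \<alpha> i) - \<gamma> i) \<in> H then c else 0)"
proof (cases "c = 0")
  case False
  then have "Poly_Mapping.keys (Poly_Mapping.single \<alpha> c) = {\<alpha>}" by simp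
  then show ?thesis unfolding coset_coeff_def by (simp only:) simp
qed simp

lemma coset_coeff_monom: "coset_coeff E H \<gamma> (monom \<alpha>) =
   (if Poly_Mapping.keys \<alpha> \<inter> E = {} \<and> (\<lambda>i. int (Poly_Mapping.lookup \<alpha> i) - \<gamma> i) \<in> H then 1 else 0)"
  by (simp add: monom_def coset_coeff_single)

text \<open>A sum of exponent vectors meets \<open>E\<close> exactly when one of its summands does.
  Otherwise, multiplication by a monomial merely translates the cosets.\<close>

lemma coset_coeff_single_mult:
  "coset_coeff E H \<gamma> (Poly_Mapping.single \<delta> c * p) =
     (if Poly_Mapping.keys \<delta> \<inter> E = {} then c * coset_coeff E H (\<lambda>i. \<gamma> i - int (Poly_Mapping.lookup \<delta> i)) p else 0)"
proof (induction p rule: poly_mapping_induct_add)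
  case (single u d)
  show ?case
    by (auto simp: mult_single coset_coeff_single keys_add_nat lookup_add algebra_simps)
qed (auto simp: coset_coeff_add distrib_left)

lemma coset_coeff_monom_mult:
  "coset_coeff E H \<gamma> (monom \<delta> * p) =
     (if Poly_Mapping.keys \<delta> \<inter> E = {} then coset_coeff E H (\<lambda>i. \<gamma> i - int (Poly_Mapping.lookup \<delta> i)) p else 0)"
  by (simp add: monom_def coset_coeff_single_mult)

lemma ideal_over_coset_ideal: "ideal_over R (coset_ideal E H :: 'k::comm_ring_1 mpoly set)"
proof -
  have "r * a \<in> coset_ideal E H" if "a \<in> coset_ideal E H" for r a :: "'k mpoly"
  proof (induction r rule: poly_mapping_induct_add)
    case (single u c)
    then show ?case using that by (simp add: coset_ideal_def coset_coeff_single_mult)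
  qed (simp_all add: coset_ideal_def distrib_right coset_coeff_add)
  then show ?thesis
    by (auto simp: ideal_over_def coset_coeff_add) (auto simp: coset_ideal_def coset_coeff_add)
qed

lemma coset_ideal_diff: "p \<in> coset_ideal E H \<Longrightarrow> q \<in> coset_ideal E H \<Longrightarrow> p - q \<in> coset_ideal E H"
  by (simp add: coset_ideal_def coset_coeff_diff)

lemma coset_ideal_mult: "p \<in> coset_ideal E H \<Longrightarrow> r * p \<in> coset_ideal E H"
  by (rule ideal_over_mult[OF ideal_over_coset_ideal UNIV_I])

text \<open>A monomial free of variables from \<open>E\<close> becomes a unit in the group ring. On
  the functionals, its inverse is the translation of cosets by \<delta>.\<close>

lemma coset_ideal_cancel_single:
  fixes c :: "'k::idom"
  assumes "Poly_Mapping.single \<delta> c * p \<in> coset_ideal E H" "c \<noteq> 0" "Poly_Mapping.keys \<delta> \<inter> E = {}"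
  shows "p \<in> coset_ideal E H"
  unfolding coset_ideal_def
proof (intro CollectI allI)
  fix \<gamma>
  have "coset_coeff E H (\<lambda>i. \<gamma> i + int (Poly_Mapping.lookup \<delta> i)) (Poly_Mapping.single \<delta> c * p) = 0"
    using assms(1) by (simp add: coset_ideal_def)
  then show "coset_coeff E H \<gamma> p = 0"
    using assms(2,3) by (simp add: coset_coeff_single_mult)
qed

lemma monom_in_coset_ideal: "Poly_Mapping.keys \<alpha> \<inter> E \<noteq> {} \<Longrightarrow> monom \<alpha> \<in> coset_ideal E H"
  by (simp add: coset_ideal_def coset_coeff_monom)

lemma binomial_in_coset_ideal_iff:
  assumes H: "int_subgroup H" and "Poly_Mapping.keys \<alpha> \<inter> E = {}" "Poly_Mapping.keys \<beta> \<inter> E = {}"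
  shows "monom \<alpha> - monom \<beta> \<in> (coset_ideal E H :: 'k::comm_ring_1 mpoly set) \<longleftrightarrow>
    (\<lambda>i. int (Poly_Mapping.lookup \<alpha> i) - int (Poly_Mapping.lookup \<beta> i)) \<in> H" (is "?l \<longleftrightarrow> ?r")
proof
  assume ?l
  \<comment> \<open>At the coset of \<beta> the functional is 1 on the second monomial, so it cannot
    be 0 on the first.\<close>
  then have "coset_coeff E H (\<lambda>i. int (Poly_Mapping.lookup \<beta> i)) (monom \<alpha> - monom \<beta> :: 'k mpoly) = 0"
    by (simp add: coset_ideal_def)
  then show ?r
    using assms by (simp add: coset_coeff_diff coset_coeff_monom int_subgroup_0 split: if_splits)
next
  assume r: ?r
  have "(\<lambda>i. int (Poly_Mapping.lookup \<alpha> i) - \<gamma> i) \<in> H \<longleftrightarrow> (\<lambda>i. int (Poly_Mapping.lookup \<beta> i) - \<gamma> i) \<in> H" for \<gamma>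
    using int_subgroup_add[OF H r, of "\<lambda>i. int (Poly_Mapping.lookup \<beta> i) - \<gamma> i"]
      int_subgroup_diff[OF H _ r, of "\<lambda>i. int (Poly_Mapping.lookup \<alpha> i) - \<gamma> i"]
    by auto
  then show ?l using assms by (simp add: coset_ideal_def coset_coeff_diff coset_coeff_monom)
qed

text \<open>Killing the variables in \<open>E\<close> sends the second monomial to 0. Only the k-th
  power of the first survives, with coefficient 1 at its own coset.\<close>

lemma binomial_power_notin_coset_ideal:
  assumes H: "int_subgroup H" and "Poly_Mapping.keys \<alpha> \<inter> E = {}" "Poly_Mapping.keys \<beta> \<inter> E \<noteq> {}"
  shows "(monom \<alpha> - monom \<beta>) ^ k \<notin> (coset_ideal E H :: 'k::comm_ring_1 mpoly set)"
proof -
  have "coset_coeff E H (\<lambda>i. int k * int (Poly_Mapping.lookup \<alpha> i)) ((monom \<alpha> - monom \<beta> :: 'k mpoly) ^ k) = 1"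
  proof (induction k)
    case 0
    show ?case using coset_coeff_monom[of E H "\<lambda>_. 0" 0] H by (simp add: monom_0 int_subgroup_0)
  next
    case (Suc k)
    then show ?case
      using assms by (simp add: left_diff_distrib coset_coeff_diff coset_coeff_monom_mult distrib_right)
  qed
  then have "coset_coeff E H (\<lambda>i. int k * int (Poly_Mapping.lookup \<alpha> i)) ((monom \<alpha> - monom \<beta> :: 'k mpoly) ^ k) \<noteq> 0"
    by simp
  then show ?thesis unfolding coset_ideal_def by blast
qed

text \<open>A first-order Taylor expansion about y: modulo (x - y)^2 only the derivative term
  remains. In characteristic 0 its integer factor is invertible, which lets a nilpotency exponent
  descend.\<close>

lemma power_diff_expansion:
  fixes x y :: "'a::comm_ring_1"
  shows "\<exists>t. x ^ Suc m - y ^ Suc m = (x - y) * (of_nat (Suc m) * y ^ m + (x - y) * t)"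
proof (induction m)
  case (Suc m)
  then obtain t where t: "x ^ Suc m - y ^ Suc m = (x - y) * (of_nat (Suc m) * y ^ m + (x - y) * t)" by blast
  have "x ^ Suc (Suc m) - y ^ Suc (Suc m) = x * (x ^ Suc m - y ^ Suc m) + (x - y) * y ^ Suc m"
    by (simp add: algebra_simps)
  also have "\<dots> = (x - y) * (of_nat (Suc (Suc m)) * y ^ Suc m + (x - y) * (of_nat (Suc m) * y ^ m + x * t))"
    unfolding t by (simp add: algebra_simps)
  finally show ?case by blast
qed (auto intro: exI[of _ 0])

text \<open>In characteristic p, raising to a power of p not below k suffices. In characteristic 0
  either \<alpha> - \<beta> has finite order modulo \<open>H\<close>, and the exponent descends to 1
  by the Taylor expansion, or it has infinite order, and the leading term of the power cannot
  cancel.\<close>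

lemma binomial_power_in_coset_ideal:
  fixes \<alpha> \<beta> :: "nat \<Rightarrow>\<^sub>0 nat"
  defines "D \<equiv> (\<lambda>c i. int c * (int (Poly_Mapping.lookup \<alpha> i) - int (Poly_Mapping.lookup \<beta> i)))"
  assumes H: "int_subgroup H" and \<alpha>: "Poly_Mapping.keys \<alpha> \<inter> E = {}" and \<beta>: "Poly_Mapping.keys \<beta> \<inter> E = {}"
    and mem: "(monom \<alpha> - monom \<beta>) ^ k \<in> (coset_ideal E H :: 'k::field mpoly set)"
  obtains q where "frob_exp TYPE('k) q" "D q \<in> H"
proof -
  let ?x = "monom \<alpha> :: 'k mpoly" and ?y = "monom \<beta> :: 'k mpoly"
  have keys_scale: "Poly_Mapping.keys (exp_scale c u) \<inter> E = {}" if "Poly_Mapping.keys u \<inter> E = {}" for c and u :: "nat \<Rightarrow>\<^sub>0 nat"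
    using that by (auto simp: in_keys_iff)
  have powers: "?x ^ c - ?y ^ c \<in> coset_ideal E H \<longleftrightarrow> D c \<in> H" for c
    using binomial_in_coset_ideal_iff[OF H keys_scale[OF \<alpha>] keys_scale[OF \<beta>], of c c, where 'k = 'k]
    by (simp add: monom_power D_def right_diff_distrib)
  show thesis
  proof (cases "CHAR('k) = 0")
    case False
    \<comment> \<open>The exponent k itself is large enough, since p >= 2 forces p^k >= k.\<close>
    define q where "q = CHAR('k) ^ k"
    have q: "frob_exp TYPE('k) q" using False by (auto simp: frob_exp_def q_def)
    have "prime CHAR('k)" using False by (simp add: prime_CHAR_semidom)
    then have "k \<le> q" unfolding q_def
      by (intro less_imp_le power_gt_expt prime_gt_Suc_0_nat)
    then have "(?x - ?y) ^ q = (?x - ?y) ^ (q - k) * (?x - ?y) ^ k" by (simp flip: power_add)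
    then have "(?x - ?y) ^ q \<in> coset_ideal E H" using coset_ideal_mult[OF mem] by simp
    then show thesis using that q powers frob_diff[OF q, of ?x ?y] by simp
  next
    case True
    then have frob1: "frob_exp TYPE('k) 1" by (simp add: frob_exp_def)
    show thesis
    proof (cases "\<exists>m. D (Suc m) \<in> H")
      case True
      then obtain m where "D (Suc m) \<in> H" by blast
      then have xy: "?x ^ Suc m - ?y ^ Suc m \<in> coset_ideal E H" using powers by blast
      obtain t where t: "?x ^ Suc m - ?y ^ Suc m = (?x - ?y) * (of_nat (Suc m) * ?y ^ m + (?x - ?y) * t)"
        using power_diff_expansion by blast
      \<comment> \<open>Multiplied by (x - y)^j, the expansion leaves (m + 1) y^m (x - y)^(j + 1)
        modulo the ideal. The factor in front is a nonzero scalar times a monomial off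
        \<open>E\<close>, so it cancels.\<close>
      have descend: "(?x - ?y) ^ Suc j \<in> coset_ideal E H" if "(?x - ?y) ^ Suc (Suc j) \<in> coset_ideal E H" for j
      proof -
        have "(?x - ?y) ^ j * (?x ^ Suc m - ?y ^ Suc m) - t * (?x - ?y) ^ Suc (Suc j) \<in> coset_ideal E H"
          by (intro coset_ideal_diff[OF coset_ideal_mult[OF xy] coset_ideal_mult[OF that]])
        also have "(?x - ?y) ^ j * (?x ^ Suc m - ?y ^ Suc m) - t * (?x - ?y) ^ Suc (Suc j)
            = of_nat (Suc m) * ?y ^ m * (?x - ?y) ^ Suc j"
          unfolding t by (simp add: algebra_simps)
        also have "of_nat (Suc m) * ?y ^ m = Poly_Mapping.single (exp_scale m \<beta>) (of_nat (Suc m))"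
          by (simp only: single_of_nat[symmetric] monom_power) (simp add: monom_def mult_single del: single_of_nat)
        finally show ?thesis
        proof (rule coset_ideal_cancel_single)
          show "(of_nat (Suc m) :: 'k) \<noteq> 0"
            using \<open>CHAR('k) = 0\<close> unfolding of_nat_eq_0_iff_char_dvd by simp
        qed (rule keys_scale[OF \<beta>])
      qed
      \<comment> \<open>One more factor is added because \<open>k\<close> may be 0, whereas the
        descent ends at exponent 1.\<close>
      have "(?x - ?y) ^ Suc k \<in> coset_ideal E H" using coset_ideal_mult[OF mem] by simp
      then have "(?x - ?y) ^ Suc 0 \<in> coset_ideal E H"
        by (induction k) (use descend in auto)
      then have "D 1 \<in> H" using powers[of 1] by simp
      then show thesis using that frob1 by blast
    next
      case False
      \<comment> \<open>The terms of the power have exponents c \<alpha> - i (\<alpha> - \<beta>)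
        with i >= 0. Their distance from c \<alpha> + j (\<alpha> - \<beta>) is -(i + j) (\<alpha> -
        \<beta>), which lies in \<open>H\<close> only for i = j = 0. The induction needs general j,
        since the factor y replaces j by j + 1.\<close>
      have "coset_coeff E H (\<lambda>i. int c * int (Poly_Mapping.lookup \<alpha> i) + D j i) ((?x - ?y) ^ c)
          = (if j = 0 then 1 else 0)" for c j
      proof (induction c arbitrary: j)
        case 0
        have "(\<lambda>i. - D j i) \<in> H \<longleftrightarrow> j = 0"
          unfolding int_subgroup_uminus_iff[OF H] using False int_subgroup_0[OF H]
          by (cases j) (auto simp: D_def)
        then show ?case using coset_coeff_monom[of E H "D j" 0, where 'a = 'k] by (simp add: monom_0)
      next
        case (Suc c)
        have "(\<lambda>i. int (Suc c) * int (Poly_Mapping.lookup \<alpha> i) + D j i - int (Poly_Mapping.lookup \<alpha> i))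
            = (\<lambda>i. int c * int (Poly_Mapping.lookup \<alpha> i) + D j i)"
          by (simp add: algebra_simps)
        moreover have "(\<lambda>i. int (Suc c) * int (Poly_Mapping.lookup \<alpha> i) + D j i - int (Poly_Mapping.lookup \<beta> i))
            = (\<lambda>i. int c * int (Poly_Mapping.lookup \<alpha> i) + D (Suc j) i)"
          by (simp add: D_def algebra_simps)
        ultimately show ?case
          using \<alpha> \<beta> Suc.IH[of j] Suc.IH[of "Suc j"]
          by (simp add: left_diff_distrib coset_coeff_diff coset_coeff_monom_mult del: of_nat_Suc)
      qed
      from this[of k 0] mem have False by (simp add: coset_ideal_def)
      then show thesis ..
    qed
  qed
qed

section \<open>Toric ideals and the lattice of a prime\<close>

lemma toric_ideal_subset_polys: "toric_ideal M m n \<subseteq> polys n"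
  by (auto simp: toric_ideal_def)

lemma ideal_over_toric_ideal: "ideal_over (polys n) (toric_ideal M m n :: 'k::comm_ring_1 mpoly set)"
  using is_subring_0[OF is_subring_polys] is_subring_add[OF is_subring_polys]
    is_subring_mult[OF is_subring_polys]
  by (auto simp: ideal_over_def toric_ideal_def toric_map_simps push_add)

text \<open>Laurent polynomials over a field form a domain, so the kernel of
  \<open>toric_map\<close> is a radical ideal.\<close>

lemma toric_ideal_power:
  fixes p :: "'k::field mpoly"
  assumes "p \<in> polys n" "p ^ k \<in> toric_ideal M m n"
  shows "p \<in> toric_ideal M m n"
  using assms by (auto simp: toric_ideal_def toric_map_simps)

lemma binomial_in_toric_ideal_iff:
  assumes "Poly_Mapping.keys u \<subseteq> {..<n}" "Poly_Mapping.keys v \<subseteq> {..<n}"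
  shows "(monom u - monom v :: 'k::comm_ring_1 mpoly) \<in> toric_ideal M m n \<longleftrightarrow> mat_exp M m u = mat_exp M m v"
proof -
  have "(monom u - monom v :: 'k mpoly) \<in> polys n"
    using is_subring_polys assms unfolding is_subring_def by (blast intro: monom_in_polys)
  moreover have "Poly_Mapping.single a (1::'k) = Poly_Mapping.single b 1 \<longleftrightarrow> a = b" for a b :: "nat \<Rightarrow>\<^sub>0 int"
    by (metis lookup_single_eq lookup_single_not_eq zero_neq_one)
  ultimately show ?thesis
    by (simp add: toric_ideal_def toric_map_simps monom_def)
qed

text \<open>If each exponent in the support of p is replaced by a representative \<open>r u\<close>
  of its fibre, the terms cancel fibrewise. Hence p is a combination of the binomials
  \<open>monom u - monom (r u)\<close>, that is, toric ideals are generated by binomials.\<close>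

lemma toric_ideal_subset:
  fixes I :: "'k::comm_ring_1 mpoly set"
  assumes I: "ideal_over (polys n) I"
    and bin: "\<And>u v. Poly_Mapping.keys u \<subseteq> {..<n} \<Longrightarrow> Poly_Mapping.keys v \<subseteq> {..<n} \<Longrightarrow>
       mat_exp M m u = mat_exp M m v \<Longrightarrow> monom u - monom v \<in> I"
  shows "toric_ideal M m n \<subseteq> I"
proof
  fix p :: "'k mpoly" assume "p \<in> toric_ideal M m n"
  then have p: "p \<in> polys n" "push (mat_exp M m) p = 0"
    by (simp_all add: toric_ideal_def toric_map_eq_push)
  let ?K = "Poly_Mapping.keys p" and ?c = "Poly_Mapping.lookup p"
  define r where "r u = (SOME v. v \<in> ?K \<and> mat_exp M m v = mat_exp M m u)" for u
  have r: "r u \<in> ?K \<and> mat_exp M m (r u) = mat_exp M m u" if "u \<in> ?K" for u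
    unfolding r_def by (rule someI[of _ u]) (use that in auto)
  have "(\<Sum>u\<in>?K. Poly_Mapping.single (r u) (?c u)) = 0"
    by (rule push_eq_0_imp_sum_eq_0[OF p(2)]) (simp_all add: single_add r_def)
  then have "p = (\<Sum>u\<in>?K. Poly_Mapping.single u (?c u)) - (\<Sum>u\<in>?K. Poly_Mapping.single (r u) (?c u))"
    using poly_mapping_monomials[of p] by simp
  also have "\<dots> = (\<Sum>u\<in>?K. Poly_Mapping.single 0 (?c u) * (monom u - monom (r u)))"
    by (simp add: sum_subtractf[symmetric] monom_def right_diff_distrib mult_single)
  also have "\<dots> \<in> I"
  proof (rule ideal_over_sum[OF I], rule ideal_over_mult[OF I])
    fix u assume "u \<in> ?K"
    then show "monom u - monom (r u) \<in> I"
      using r[of u] p(1) by (intro bin) (auto simp: polys_def)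
  qed (simp add: polys_def)
  finally show "p \<in> I" .
qed

section \<open>Lattice vectors and their images under N\<close>

lemma keys_subset_lessThan:
  fixes u :: "nat \<Rightarrow>\<^sub>0 nat"
  shows "Poly_Mapping.keys u \<subseteq> {..<n} \<longleftrightarrow> (\<forall>j\<ge>n. Poly_Mapping.lookup u j = 0)"
  unfolding subset_iff in_keys_iff lessThan_iff by (meson not_less)

lemma hat_exp_in_int_kernel_iff:
  assumes "Poly_Mapping.keys u \<subseteq> {..<n}" "Poly_Mapping.keys v \<subseteq> {..<n}"
  shows "hat_exp u v \<in> int_kernel M m n \<longleftrightarrow> mat_exp M m u = mat_exp M m v"
proof -
  have "hat_exp u v j = 0" if "j \<ge> n" for j
    using assms that by (simp add: hat_exp_def keys_subset_lessThan)
  moreover have "mat_exp M m u = mat_exp M m v \<longleftrightarrow> (\<forall>i<m. (\<Sum>j<n. M i j * hat_exp u v j) = 0)"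
    using assms
    by (auto simp: poly_mapping_eq_iff fun_eq_iff lookup_mat_exp[OF finite_lessThan] hat_exp_def
        right_diff_distrib sum_subtractf)
  ultimately show ?thesis by (simp add: int_kernel_def)
qed

text \<open>The positive and negative parts of \<open>w\<close> serve as \<open>u\<close> and
  \<open>v\<close>, so every kernel vector comes from a binomial of the toric ideal.\<close>

lemma int_kernel_cases:
  assumes "w \<in> int_kernel M m n"
  obtains u v where "w = hat_exp u v" "Poly_Mapping.keys u \<subseteq> {..<n}" "Poly_Mapping.keys v \<subseteq> {..<n}"
    "mat_exp M m u = mat_exp M m v"
proof -
  define u where "u = Abs_poly_mapping (\<lambda>j. nat (w j))"
  define v where "v = Abs_poly_mapping (\<lambda>j. nat (- w j))"
  have w0: "w j = 0" if "j \<ge> n" for j using assms that by (simp add: int_kernel_def)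
  have "finite {j. nat (w j) \<noteq> 0}" "finite {j. nat (- w j) \<noteq> 0}"
    by (rule finite_subset[of _ "{..<n}"]; use w0 in \<open>force simp: not_less[symmetric]\<close>)+
  then have lookup: "Poly_Mapping.lookup u j = nat (w j)" "Poly_Mapping.lookup v j = nat (- w j)" for j
    by (simp_all add: u_def v_def)
  then have keys: "Poly_Mapping.keys u \<subseteq> {..<n}" "Poly_Mapping.keys v \<subseteq> {..<n}"
    using w0 by (simp_all add: keys_subset_lessThan)
  have "w = hat_exp u v" by (auto simp: hat_exp_def lookup fun_eq_iff)
  with that[OF this keys] keys assms hat_exp_in_int_kernel_iff[OF keys, of M m] show thesis by simp
qed

lemma yvec_hat_exp:
  assumes "Poly_Mapping.keys u \<subseteq> {..<n}" "Poly_Mapping.keys v \<subseteq> {..<n}"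
  shows "yvec N l n (hat_exp u v) =
    (\<lambda>i. int (Poly_Mapping.lookup (nat_mat_exp N l u) i) - int (Poly_Mapping.lookup (nat_mat_exp N l v) i))"
  using assms
  by (auto simp: yvec_def hat_exp_def fun_eq_iff lookup_nat_mat_exp[OF finite_lessThan]
      right_diff_distrib sum_subtractf)

lemma yvec_diff: "yvec N l n (\<lambda>i. u i - v i) = (\<lambda>i. yvec N l n u i - yvec N l n v i)"
  by (auto simp: yvec_def fun_eq_iff right_diff_distrib sum_subtractf)

lemma yvec_0: "yvec N l n (\<lambda>_. 0) = (\<lambda>_. 0)"
  by (auto simp: yvec_def)

lemma int_subgroup_int_kernel: "int_subgroup (int_kernel M m n)"
  by (auto simp: int_subgroup_def int_kernel_def right_diff_distrib sum_subtractf)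

lemma int_subgroup_yvec_image:
  assumes "int_subgroup K"
  shows "int_subgroup (yvec N l n ` K)"
  unfolding int_subgroup_def
proof (intro conjI ballI)
  show "(\<lambda>_. 0) \<in> yvec N l n ` K"
    using yvec_0[of N l n] int_subgroup_0[OF assms] by force
  fix a b assume "a \<in> yvec N l n ` K" "b \<in> yvec N l n ` K"
  then obtain u v where "u \<in> K" "v \<in> K" "a = yvec N l n u" "b = yvec N l n v" by blast
  then show "(\<lambda>i. a i - b i) \<in> yvec N l n ` K"
    using int_subgroup_diff[OF assms] by (auto simp flip: yvec_diff)
qed

text \<open>In characteristic p the kernel vectors w with p^k y_w in \<open>G\<close> form subgroups
  that increase with k and exhaust the kernel. The chain becomes stationary on it, which gives one
  exponent for all w.\<close>

lemma uniform_frob_exp: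
  assumes G: "int_subgroup G"
    and each: "\<And>w. w \<in> int_kernel M m n \<Longrightarrow> \<exists>q. frob_exp TYPE('k::field) q \<and> (\<lambda>i. int q * yvec N l n w i) \<in> G"
  shows "\<exists>q. frob_exp TYPE('k) q \<and> (\<forall>y\<in>yvec N l n ` int_kernel M m n. (\<lambda>i. int q * y i) \<in> G)"
proof (cases "CHAR('k) = 0")
  case True
  then show ?thesis using each by (auto simp: frob_exp_def)
next
  case False
  define Q where "Q k = {w. (\<lambda>i. int (CHAR('k) ^ k) * yvec N l n w i) \<in> G}" for k
  have "int_subgroup (Q k)" for k
    using int_subgroup_0[OF G] int_subgroup_diff[OF G]
    unfolding int_subgroup_def Q_def by (force simp: yvec_diff yvec_0 right_diff_distrib)
  moreover have "Q k \<subseteq> Q (Suc k)" for k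
    unfolding Q_def using int_subgroup_scale[OF G, of _ "int CHAR('k)"] by (fastforce simp: mult.assoc)
  moreover have "int_kernel M m n \<subseteq> (\<Union>k. Q k)"
    using each False by (fastforce simp: frob_exp_def Q_def)
  ultimately obtain k where "int_kernel M m n \<subseteq> Q k"
    using int_subgroup_chain_stationary[of "int_kernel M m n" n Q, OF int_subgroup_int_kernel]
    by (auto simp: int_kernel_def)
  then show ?thesis
    using False by (intro exI[of _ "CHAR('k) ^ k"]) (auto simp: frob_exp_def Q_def)
qed

section \<open>Zero pattern and lattice of a prime\<close>

lemma prime_over_diff_iff:
  assumes "is_subring R" "prime_over R P" "a - b \<in> P"
  shows "a \<in> P \<longleftrightarrow> b \<in> P"
proof -
  have P: "ideal_over R P" using assms by (simp add: prime_over_def)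
  show ?thesis
    using ideal_over_add[OF P assms(3), of b] ideal_over_diff[OF assms(1) P _ assms(3), of a] by auto
qed

text \<open>The variables outside a prime \<open>P \<supseteq> I\<^sub>N\<close> have as indicator vector a point of \<open>V(I\<^sub>N)\<close>,
  which \<open>\<Gamma>(N) = V(I\<^sub>N)\<close> parametrises by some \<open>T\<close>; \<open>E\<close> is the zero pattern of \<open>T\<close>.\<close>
lemma prime_zero_pattern:
  fixes emb :: "'k::field \<Rightarrow> 'c::alg_closed_field" and N :: "nat \<Rightarrow> nat \<Rightarrow> nat" and l n :: nat
  defines "IN \<equiv> (toric_ideal (\<lambda>i j. int (N i j)) l n :: 'k mpoly set)"
  assumes closure: "is_alg_closure emb"
    and Gamma_eq: "(Gamma N l n :: (nat \<Rightarrow> 'c) set) = zero_set emb n IN"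
    and P: "prime_over (polys n) P" "IN \<subseteq> P"
  obtains E where "E \<subseteq> {..<l}"
    "\<And>u. Poly_Mapping.keys u \<subseteq> {..<n} \<Longrightarrow> monom u \<in> P \<longleftrightarrow> Poly_Mapping.keys (nat_mat_exp N l u) \<inter> E \<noteq> {}"
proof -
  \<comment> \<open>As \<open>P\<close> is prime, a monomial avoids \<open>P\<close> exactly when
    all its variables belong to \<open>F\<close>.\<close>
  define F where "F = {j. j < n \<and> var j \<notin> P}"
  have F: "monom u \<in> P \<longleftrightarrow> \<not> Poly_Mapping.keys u \<subseteq> F" if "Poly_Mapping.keys u \<subseteq> {..<n}" for u
    using that
  proof (induction u rule: poly_mapping_induct_add)
    case zero
    then show ?case using P by (simp add: monom_0 prime_over_def)
  next
    case (single j c)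
    show ?case
    proof (cases "c = 0")
      case False
      then have j: "j < n" using single by simp
      have "monom (Poly_Mapping.single j c) = (var j ^ c :: 'k mpoly)"
        unfolding var_def monom_power by (rule arg_cong[of _ _ monom], rule poly_mapping_eqI) (simp add: lookup_single "when_def")
      moreover have "var j ^ c \<in> P \<longleftrightarrow> var j \<in> P"
      proof
        assume "var j ^ c \<in> P"
        then show "var j \<in> P" by (rule prime_over_power[OF is_subring_polys P(1) var_in_polys[OF j]])
      next
        assume "var j \<in> P"
        then have "var j ^ (c - 1) * var j \<in> P"
          using P(1) is_subring_power[OF is_subring_polys var_in_polys[OF j]]
          by (auto simp: prime_over_def intro: ideal_over_mult)
        then show "var j ^ c \<in> P" using False by (simp flip: power_Suc2)
      qed
      ultimately show ?thesis using False j by (simp add: F_def)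
    qed (use P in \<open>simp add: monom_0 prime_over_def\<close>)
  next
    case (add u v)
    then have k: "Poly_Mapping.keys u \<subseteq> {..<n}" "Poly_Mapping.keys v \<subseteq> {..<n}" by (simp_all add: keys_add_nat)
    then have R: "monom u \<in> (polys n :: 'k mpoly set)" "monom v \<in> (polys n :: 'k mpoly set)"
      by (simp_all add: monom_in_polys)
    have I: "ideal_over (polys n) P" using P by (simp add: prime_over_def)
    have "monom u * monom v \<in> P \<longleftrightarrow> monom u \<in> P \<or> monom v \<in> P"
      using P(1) R ideal_over_mult[OF I R(1), of "monom v"] ideal_over_mult[OF I R(2), of "monom u"]
      by (auto simp: prime_over_def mult.commute)
    then show ?case using add.IH k by (simp add: monom_mult keys_add_nat)
  qed
  define z where "z = (\<lambda>j. if j \<in> F then 1 else 0 :: 'c)"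
  have emb: "emb (a + b) = emb a + emb b" "emb 0 = 0" for a b
  proof -
    have add: "emb (a + b) = emb a + emb b" for a b using closure by (simp add: is_alg_closure_def)
    show "emb (a + b) = emb a + emb b" by (rule add)
    have "emb 0 + emb 0 = emb 0 + 0" using add[of 0 0] by simp
    then show "emb 0 = 0" by (simp only: add_left_cancel)
  qed
  \<comment> \<open>At \<open>z\<close> a monomial has value 1 if it lies outside \<open>P\<close>
    and 0 otherwise. This value is constant on the fibres of N, because monomials with equal image
    differ by an element of I_N, hence of \<open>P\<close>.\<close>
  have "mpoly_eval emb p z = 0" if p: "p \<in> IN" for p
  proof -
    have z_monom: "(\<Prod>i\<in>Poly_Mapping.keys u. z i ^ Poly_Mapping.lookup u i) = (if Poly_Mapping.keys u \<subseteq> F then 1 else 0)" for u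
    proof (cases "Poly_Mapping.keys u \<subseteq> F")
      case True
      then show ?thesis by (auto intro!: prod.neutral simp: z_def)
    next
      case False
      then obtain i where "i \<in> Poly_Mapping.keys u" "i \<notin> F" by blast
      then have "z i ^ Poly_Mapping.lookup u i = 0" by (simp add: z_def in_keys_iff)
      then show ?thesis using False \<open>i \<in> Poly_Mapping.keys u\<close> by (auto intro!: prod_zero)
    qed
    have keys_p: "Poly_Mapping.keys u \<subseteq> {..<n}" if "u \<in> Poly_Mapping.keys p" for u
      using p that toric_ideal_subset_polys unfolding IN_def polys_def by blast
    show ?thesis unfolding mpoly_eval_def z_monom
    proof (rule push_eq_0_imp_sum_eq_0[where a = "\<lambda>w c. emb c * w" and h = "mat_exp (\<lambda>i j. int (N i j)) l"])
      show "push (mat_exp (\<lambda>i j. int (N i j)) l) p = 0"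
        using p by (simp add: IN_def toric_ideal_def toric_map_eq_push)
      fix u v
      assume uv: "u \<in> Poly_Mapping.keys p" "v \<in> Poly_Mapping.keys p"
        "mat_exp (\<lambda>i j. int (N i j)) l u = mat_exp (\<lambda>i j. int (N i j)) l v"
      then have "monom u - monom v \<in> IN"
        unfolding IN_def by (simp add: binomial_in_toric_ideal_iff keys_p)
      then have "monom u \<in> P \<longleftrightarrow> monom v \<in> P"
        using P(2) prime_over_diff_iff[OF is_subring_polys P(1)] by blast
      then show "(if Poly_Mapping.keys u \<subseteq> F then 1 else 0 :: 'c) = (if Poly_Mapping.keys v \<subseteq> F then 1 else 0)"
        using F keys_p uv by simp
    qed (simp_all add: emb distrib_right)
  qed
  then have "z \<in> Gamma N l n"
    unfolding Gamma_eq zero_set_def by (auto simp: affine_space_def z_def F_def)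
  then obtain T where T: "z = (\<lambda>j. if j < n then (\<Prod>i<l. T i ^ N i j) else 0)"
    by (auto simp: Gamma_def)
  define E where "E = {i. i < l \<and> T i = 0}"
  \<comment> \<open>A coordinate of the parametrised point vanishes exactly when some vanishing
    parameter occurs in it with positive exponent; here 0^0 = 1 matters.\<close>
  have F_iff: "j \<in> F \<longleftrightarrow> (\<forall>i\<in>E. N i j = 0)" if "j < n" for j
  proof -
    have "z j = (\<Prod>i<l. T i ^ N i j)" using T that by simp
    moreover have "j \<in> F \<longleftrightarrow> z j \<noteq> 0" by (simp add: z_def)
    ultimately have "j \<in> F \<longleftrightarrow> (\<Prod>i<l. T i ^ N i j) \<noteq> 0" by simp
    also have "\<dots> \<longleftrightarrow> (\<forall>i\<in>E. N i j = 0)" by (auto simp: E_def)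
    finally show ?thesis .
  qed
  show thesis
  proof (rule that[of E])
    show "E \<subseteq> {..<l}" by (auto simp: E_def)
    fix u :: "nat \<Rightarrow>\<^sub>0 nat" assume u: "Poly_Mapping.keys u \<subseteq> {..<n}"
    have "Poly_Mapping.keys (nat_mat_exp N l u) \<inter> E = {} \<longleftrightarrow> (\<forall>i\<in>E. Poly_Mapping.lookup (nat_mat_exp N l u) i = 0)"
      by (auto simp: disjoint_iff in_keys_iff)
    also have "\<dots> \<longleftrightarrow> (\<forall>i\<in>E. \<forall>j\<in>Poly_Mapping.keys u. N i j = 0)"
      by (intro ball_cong refl) (auto simp: in_keys_iff lookup_nat_mat_exp[OF finite_keys subset_refl] E_def)
    also have "\<dots> \<longleftrightarrow> Poly_Mapping.keys u \<subseteq> F" using F_iff u by blast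
    finally show "monom u \<in> P \<longleftrightarrow> Poly_Mapping.keys (nat_mat_exp N l u) \<inter> E \<noteq> {}"
      using F[OF u] by blast
  qed
qed

text \<open>Monomials outside \<open>P\<close> are nonzero in the domain K[x]/P, and the lattice
  collects the N-differences of those with equal residue there. Two monomials inside
  \<open>P\<close> are always congruent and would carry no information.\<close>

definition prime_lattice :: "(nat \<Rightarrow> nat \<Rightarrow> nat) \<Rightarrow> nat \<Rightarrow> nat \<Rightarrow> 'k::comm_ring_1 mpoly set \<Rightarrow> (nat \<Rightarrow> int) set" where
  "prime_lattice N l n P = {yvec N l n (hat_exp a b) | a b.
     Poly_Mapping.keys a \<subseteq> {..<n} \<and> Poly_Mapping.keys b \<subseteq> {..<n} \<and>
     monom a \<notin> P \<and> monom b \<notin> P \<and> monom a - monom b \<in> P}"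

text \<open>Differences are realised crosswise: the pairs (a, b) and (a', b') yield (a + b', b +
  a'). Primality keeps these products of monomials outside \<open>P\<close>.\<close>

lemma int_subgroup_prime_lattice:
  fixes P :: "'k::comm_ring_1 mpoly set"
  assumes P: "prime_over (polys n) P"
  shows "int_subgroup (prime_lattice N l n P)"
  unfolding int_subgroup_def
proof (intro conjI ballI)
  have I: "ideal_over (polys n) P" using P by (simp add: prime_over_def)
  have "hat_exp 0 0 = (\<lambda>_. 0)" by (simp add: hat_exp_def fun_eq_iff)
  then have "(\<lambda>_. 0) = yvec N l n (hat_exp 0 0)" by (simp add: yvec_0)
  moreover have "monom 0 \<notin> P" "monom 0 - monom 0 \<in> P"
    using P I by (simp_all add: monom_0 prime_over_def ideal_over_def)
  ultimately show "(\<lambda>_. 0) \<in> prime_lattice N l n P"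
    unfolding prime_lattice_def by (intro CollectI exI[of _ 0]) simp
  fix y y' assume "y \<in> prime_lattice N l n P" "y' \<in> prime_lattice N l n P"
  then obtain a b a' b' where
    y: "y = yvec N l n (hat_exp a b)" and ab: "Poly_Mapping.keys a \<subseteq> {..<n}" "Poly_Mapping.keys b \<subseteq> {..<n}"
      "monom a \<notin> P" "monom b \<notin> P" "monom a - monom b \<in> P" and
    y': "y' = yvec N l n (hat_exp a' b')" and ab': "Poly_Mapping.keys a' \<subseteq> {..<n}" "Poly_Mapping.keys b' \<subseteq> {..<n}"
      "monom a' \<notin> P" "monom b' \<notin> P" "monom a' - monom b' \<in> P"
    unfolding prime_lattice_def by blast
  have "hat_exp (a + b') (b + a') = (\<lambda>i. hat_exp a b i - hat_exp a' b' i)"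
    by (simp add: hat_exp_def fun_eq_iff lookup_add)
  then have "(\<lambda>i. y i - y' i) = yvec N l n (hat_exp (a + b') (b + a'))"
    by (simp add: y y' yvec_diff)
  moreover have "monom (a + b') \<notin> P" "monom (b + a') \<notin> P"
    using P ab ab' monom_in_polys unfolding prime_over_def by (metis monom_mult)+
  moreover have "monom (a + b') - monom (b + a') \<in> P"
  proof -
    have "monom b' * (monom a - monom b) - monom b * (monom a' - monom b') \<in> P"
      using ab ab' ideal_over_mult[OF I monom_in_polys[of b']] ideal_over_mult[OF I monom_in_polys[of b]]
      by (intro ideal_over_diff[OF is_subring_polys I])
    then show ?thesis by (simp add: right_diff_distrib monom_mult add.commute)
  qed
  moreover have "Poly_Mapping.keys (a + b') \<subseteq> {..<n}" "Poly_Mapping.keys (b + a') \<subseteq> {..<n}"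
    using ab ab' by (simp_all add: keys_add_nat)
  ultimately show "(\<lambda>i. y i - y' i) \<in> prime_lattice N l n P"
    unfolding prime_lattice_def by blast
qed

text \<open>If y_(u - v) = y_(a - b), then N(u + b) = N(v + a), so x^(u + b) - x^(v + a) lies in I_N
  and hence in \<open>P\<close>. Adding x^v (x^a - x^b) gives (x^u - x^v) x^b, and x^b cancels
  because it is not in \<open>P\<close>.\<close>

lemma binomial_in_prime_if_in_prime_lattice:
  fixes P :: "'k::comm_ring_1 mpoly set"
  assumes P: "prime_over (polys n) P" and IN: "toric_ideal (\<lambda>i j. int (N i j)) l n \<subseteq> P"
    and uv: "Poly_Mapping.keys u \<subseteq> {..<n}" "Poly_Mapping.keys v \<subseteq> {..<n}"
    and y: "yvec N l n (hat_exp u v) \<in> prime_lattice N l n P"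
  shows "monom u - monom v \<in> P"
proof -
  have I: "ideal_over (polys n) P" using P by (simp add: prime_over_def)
  obtain a b where ab: "yvec N l n (hat_exp u v) = yvec N l n (hat_exp a b)"
    "Poly_Mapping.keys a \<subseteq> {..<n}" "Poly_Mapping.keys b \<subseteq> {..<n}"
    "monom b \<notin> P" "monom a - monom b \<in> P"
    using y unfolding prime_lattice_def by blast
  have "nat_mat_exp N l (u + b) = nat_mat_exp N l (v + a)"
  proof (rule poly_mapping_eqI)
    fix i
    have "int (Poly_Mapping.lookup (nat_mat_exp N l u) i) - int (Poly_Mapping.lookup (nat_mat_exp N l v) i)
        = int (Poly_Mapping.lookup (nat_mat_exp N l a) i) - int (Poly_Mapping.lookup (nat_mat_exp N l b) i)"
      using ab(1) unfolding yvec_hat_exp[OF uv] yvec_hat_exp[OF ab(2,3)] by (rule fun_cong)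
    then show "Poly_Mapping.lookup (nat_mat_exp N l (u + b)) i = Poly_Mapping.lookup (nat_mat_exp N l (v + a)) i"
      by (simp add: nat_mat_exp_add lookup_add)
  qed
  moreover have "Poly_Mapping.keys (u + b) \<subseteq> {..<n}" "Poly_Mapping.keys (v + a) \<subseteq> {..<n}"
    using uv ab by (simp_all add: keys_add_nat)
  ultimately have "monom (u + b) - monom (v + a) \<in> P"
    using IN binomial_in_toric_ideal_iff[of "u + b" n "v + a" "\<lambda>i j. int (N i j)" l]
    by (auto simp: mat_exp_int_eq_iff)
  moreover have "monom v * (monom a - monom b) \<in> P"
    using ab uv by (intro ideal_over_mult[OF I] monom_in_polys)
  ultimately have "(monom (u + b) - monom (v + a)) + monom v * (monom a - monom b) \<in> P"
    by (rule ideal_over_add[OF I])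
  then have "(monom u - monom v) * monom b \<in> P"
    by (simp add: monom_mult[symmetric] algebra_simps)
  moreover have "(monom u - monom v :: 'k mpoly) \<in> polys n" "(monom b :: 'k mpoly) \<in> polys n"
    using is_subring_polys uv ab unfolding is_subring_def by (blast intro: monom_in_polys)+
  ultimately show ?thesis using P ab(4) unfolding prime_over_def by blast
qed

section \<open>The radical criterion\<close>

lemma phi_binomial: "phi N l (monom u - monom v) = monom (nat_mat_exp N l u) - monom (nat_mat_exp N l v)"
  by (simp add: phi_simps)

lemma ideal_over_phi_vimage:
  assumes "ideal_over (polys l) I"
  shows "ideal_over (polys n) (phi N l -` I)"
  unfolding ideal_over_def
proof (intro conjI ballI)
  show "0 \<in> phi N l -` I" using assms by (simp add: phi_eq_push ideal_over_def)
  show "a + b \<in> phi N l -` I" if "a \<in> phi N l -` I" "b \<in> phi N l -` I" for a b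
    using that ideal_over_add[OF assms] by (simp add: phi_eq_push push_add)
  show "r * a \<in> phi N l -` I" if "a \<in> phi N l -` I" for r a
    using that ideal_over_mult[OF assms phi_in_polys] by (simp add: phi_simps)
qed

text \<open>Since \<open>phi\<close> kills I_N, only the generators in \<open>S\<close> have to be
  tested. The target \<open>I\<close> will be a coset ideal for (a) and a prime for (b).\<close>

lemma phi_ideal_span_subset:
  assumes I: "ideal_over (polys l) I" and "phi N l ` S \<subseteq> I"
  shows "phi N l ` ideal_span (polys n) (toric_ideal (\<lambda>i j. int (N i j)) l n \<union> S) \<subseteq> I"
proof -
  have "phi N l p \<in> I" if "p \<in> toric_ideal (\<lambda>i j. int (N i j)) l n" for p
    using that I phi_eq_0_if_toric[of N l p] by (simp add: toric_ideal_def ideal_over_def)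
  then have "toric_ideal (\<lambda>i j. int (N i j)) l n \<union> S \<subseteq> phi N l -` I"
    using assms(2) by auto
  from ideal_span_minimal[OF ideal_over_phi_vimage[OF I] this] show ?thesis by blast
qed

lemma nat_mat_exp_exp_scale: "nat_mat_exp N l (exp_scale q u) = exp_scale q (nat_mat_exp N l u)"
proof (rule poly_mapping_eqI)
  fix i
  show "Poly_Mapping.lookup (nat_mat_exp N l (exp_scale q u)) i = Poly_Mapping.lookup (exp_scale q (nat_mat_exp N l u)) i"
    using keys_exp_scale[of q u]
    by (simp add: lookup_nat_mat_exp[of "Poly_Mapping.keys u"] sum_distrib_left mult.left_commute)
qed

theorem theorem4p4:
  fixes M :: "nat \<Rightarrow> nat \<Rightarrow> int" and N :: "nat \<Rightarrow> nat \<Rightarrow> nat"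
    and m n l s :: nat
    and emb :: "'k::field \<Rightarrow> 'c::alg_closed_field"
    and U V :: "nat \<Rightarrow> (nat \<Rightarrow>\<^sub>0 nat)"
  defines "IM \<equiv> (toric_ideal M m n :: 'k mpoly set)"
    and "IN \<equiv> (toric_ideal (\<lambda>i j. int (N i j)) l n :: 'k mpoly set)"
    and "f \<equiv> (\<lambda>j. monom (U j) - monom (V j) :: 'k mpoly)"
    and "G \<equiv> int_span s (\<lambda>j. yvec N l n (hat_exp (U j) (V j)))"
    and "NK \<equiv> yvec N l n ` int_kernel M m n"
  assumes closure: "is_alg_closure emb"
    and cols_nonzero: "\<forall>j<n. \<exists>i<l. N i j \<noteq> 0"
    and IN_sub: "IN \<subseteq> IM"
    and Gamma_eq: "(Gamma N l n :: (nat \<Rightarrow> 'c) set) = zero_set emb n IN"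
    and binom_vars: "\<forall>j<s. Poly_Mapping.keys (U j) \<subseteq> {..<n} \<and> Poly_Mapping.keys (V j) \<subseteq> {..<n}"
    and binom_in: "\<forall>j<s. f j \<in> IM"
  shows "IM = radical (polys n) (ideal_span (polys n) (IN \<union> f ` {..<s}))
     \<longleftrightarrow>
     ((if CHAR('k) \<noteq> 0
       then (\<exists>k::nat. (\<lambda>y i. int CHAR('k) ^ k * y i) ` NK \<subseteq> G)
       else NK = G)
      \<and> (\<forall>i<l. radical (polys l) (ideal_span (polys l) (phi N l ` IM \<union> {var i}))
              = radical (polys l) (ideal_span (polys l) (phi N l ` f ` {..<s} \<union> {var i}))))"
    (is "?rad \<longleftrightarrow> ?a \<and> ?b")
proof -
  note keysU = binom_vars[rule_format, THEN conjunct1]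
  note keysV = binom_vars[rule_format, THEN conjunct2]
  have f_kernel: "hat_exp (U j) (V j) \<in> int_kernel M m n" if "j < s" for j
    using binom_in[rule_format, OF that] keysU[OF that] keysV[OF that]
    by (simp add: IM_def f_def binomial_in_toric_ideal_iff hat_exp_in_int_kernel_iff)
  have G_sub: "G \<subseteq> NK"
    unfolding G_def NK_def using f_kernel
    by (intro int_span_minimal int_subgroup_yvec_image[OF int_subgroup_int_kernel]) blast
  \<comment> \<open>In characteristic 0 the only multiplier is 1, and \<open>G_sub\<close> upgrades
    the resulting inclusion to an equality.\<close>
  have a_iff: "?a \<longleftrightarrow> (\<exists>q. frob_exp TYPE('k) q \<and> (\<forall>y\<in>NK. (\<lambda>i. int q * y i) \<in> G))"
  proof (cases "CHAR('k) = 0")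
    case True
    then show ?thesis using G_sub by (auto simp: frob_exp_def)
  next
    case False
    have "(\<exists>q. (\<exists>e. q = CHAR('k) ^ e) \<and> (\<forall>y\<in>NK. (\<lambda>i. int q * y i) \<in> G))
        \<longleftrightarrow> (\<exists>e. \<forall>y\<in>NK. (\<lambda>i. int (CHAR('k) ^ e) * y i) \<in> G)"
      by blast
    then show ?thesis using False by (simp add: frob_exp_def image_subset_iff)
  qed
  let ?J = "ideal_span (polys n) (IN \<union> f ` {..<s})"
  let ?A = "\<lambda>i. ideal_span (polys l) (phi N l ` IM \<union> {var i})"
  let ?B = "\<lambda>i. ideal_span (polys l) (phi N l ` f ` {..<s} \<union> {var i})"
  have fIM: "f ` {..<s} \<subseteq> IM" using binom_in by blast
  have J_sub: "?J \<subseteq> IM"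
    unfolding IM_def by (rule ideal_span_minimal[OF ideal_over_toric_ideal])
      (use IN_sub fIM in \<open>auto simp: IM_def\<close>)
  show ?thesis
  proof (intro iffI conjI)
    assume rad: ?rad
    have power_in_J: "\<exists>k. p ^ k \<in> ?J" if "p \<in> IM" for p
      using that rad by (auto simp: radical_def)
    show ?a
      unfolding a_iff unfolding NK_def
    proof (rule uniform_frob_exp)
      show G: "int_subgroup G" unfolding G_def by (rule int_subgroup_int_span)
      fix w assume "w \<in> int_kernel M m n"
      then obtain u v where w: "w = hat_exp u v" and
        uv: "Poly_Mapping.keys u \<subseteq> {..<n}" "Poly_Mapping.keys v \<subseteq> {..<n}" "mat_exp M m u = mat_exp M m v"
        by (rule int_kernel_cases)
      then have "monom u - monom v \<in> IM"
        by (simp add: IM_def binomial_in_toric_ideal_iff)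
      then obtain k where k: "(monom u - monom v) ^ k \<in> ?J" using power_in_J by blast
      \<comment> \<open>With no variable killed, the target is the group ring of Z^l / G, where the
        two terms of \<open>f j\<close> coincide because their exponent difference is a generator of
        \<open>G\<close>.\<close>
      have "phi N l (f j) \<in> coset_ideal {} G" if "j < s" for j
        using int_span_gen[OF that, of "\<lambda>j. yvec N l n (hat_exp (U j) (V j))", folded G_def] keysU[OF that] keysV[OF that]
        by (simp add: f_def phi_binomial binomial_in_coset_ideal_iff[OF G] yvec_hat_exp)
      then have "phi N l ` ?J \<subseteq> coset_ideal {} G"
        unfolding IN_def by (intro phi_ideal_span_subset ideal_over_coset_ideal) auto
      then have "phi N l ((monom u - monom v :: 'k mpoly) ^ k) \<in> coset_ideal {} G" by (rule subsetD) (rule imageI[OF k])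
      then have "(monom (nat_mat_exp N l u) - monom (nat_mat_exp N l v)) ^ k \<in> (coset_ideal {} G :: 'k mpoly set)"
        by (simp add: phi_simps)
      from binomial_power_in_coset_ideal[OF G _ _ this]
      show "\<exists>q. frob_exp TYPE('k) q \<and> (\<lambda>i. int q * yvec N l n w i) \<in> G"
        unfolding w yvec_hat_exp[OF uv(1,2)] by blast
    qed
    show ?b
    proof (intro allI impI subset_antisym)
      fix i assume i: "i < l"
      have AR: "phi N l ` S \<union> {var i} \<subseteq> (polys l :: 'k mpoly set)" for S
        using phi_in_polys var_in_polys[OF i] by blast
      have B: "ideal_over (polys l) (?B i)" "?B i \<subseteq> polys l"
        using ideal_over_ideal_span[OF is_subring_polys] ideal_span_subset_subring[OF is_subring_polys AR] by auto
      have "?B i \<subseteq> ?A i"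
        using ideal_span_superset[OF is_subring_polys, of "phi N l ` IM \<union> {var i}" l] fIM
        by (intro ideal_span_minimal ideal_over_ideal_span is_subring_polys) blast
      then show "radical (polys l) (?B i) \<subseteq> radical (polys l) (?A i)"
        by (auto simp: radical_def)
      show "radical (polys l) (?A i) \<subseteq> radical (polys l) (?B i)"
      proof
        fix h assume "h \<in> radical (polys l) (?A i)"
        then obtain k where h: "h \<in> polys l" "h ^ k \<in> ?A i" by (auto simp: radical_def)
        \<comment> \<open>Each \<open>phi N l p\<close> has a power in the right-hand ideal, with an
          exponent depending on p. Testing on primes makes these exponents disappear.\<close>
        show "h \<in> radical (polys l) (?B i)"
        proof (rule in_radical_if_in_primes[OF is_subring_polys B h(1)])
          fix P assume P: "prime_over (polys l) P" "?B i \<subseteq> P"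
          then have I: "ideal_over (polys l) P" by (simp add: prime_over_def)
          have gens: "phi N l ` f ` {..<s} \<union> {var i} \<subseteq> P"
            using ideal_span_superset[OF is_subring_polys] P(2) by (rule subset_trans)
          have "phi N l p \<in> P" if p: "p \<in> IM" for p
          proof -
            obtain k where "p ^ k \<in> ?J" using power_in_J p by blast
            moreover have "phi N l ` ?J \<subseteq> P"
              unfolding IN_def using gens by (intro phi_ideal_span_subset[OF I]) blast
            ultimately have "phi N l p ^ k \<in> P" by (auto simp: phi_simps)
            then show ?thesis by (rule prime_over_power[OF is_subring_polys P(1) phi_in_polys])
          qed
          then have "?A i \<subseteq> P" using gens by (intro ideal_span_minimal[OF I]) blast
          then show "h \<in> P" using h prime_over_power[OF is_subring_polys P(1)] by blast
        qed
      qed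
    qed
  next
    assume ab: "?a \<and> ?b"
    obtain qa where qa: "frob_exp TYPE('k) qa" "\<And>y. y \<in> NK \<Longrightarrow> (\<lambda>i. int qa * y i) \<in> G"
      using ab[THEN conjunct1] unfolding a_iff by blast
    have J: "ideal_over (polys n) ?J" "?J \<subseteq> polys n"
      using subset_trans[OF J_sub[unfolded IM_def] toric_ideal_subset_polys]
      by (simp_all add: ideal_over_ideal_span[OF is_subring_polys])
    have "IM \<subseteq> P" if P: "prime_over (polys n) P" "?J \<subseteq> P" for P
    proof -
      have I: "ideal_over (polys n) P" using P by (simp add: prime_over_def)
      have "IN \<union> f ` {..<s} \<subseteq> P"
        using ideal_span_superset[OF is_subring_polys] P(2) by (rule subset_trans)
      then have IN_P: "IN \<subseteq> P" and f_P: "\<And>j. j < s \<Longrightarrow> f j \<in> P" by auto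
      obtain E where E: "E \<subseteq> {..<l}"
        and pattern: "\<And>u. Poly_Mapping.keys u \<subseteq> {..<n} \<Longrightarrow> monom u \<in> P \<longleftrightarrow> Poly_Mapping.keys (nat_mat_exp N l u) \<inter> E \<noteq> {}"
        using prime_zero_pattern[OF closure Gamma_eq[unfolded IN_def] P(1) IN_P[unfolded IN_def]] by blast
      define H where "H = prime_lattice N l n P"
      have H: "int_subgroup H" unfolding H_def by (rule int_subgroup_prime_lattice[OF P(1)])
      have f_H: "yvec N l n (hat_exp (U j) (V j)) \<in> H" if "j < s" "monom (U j) \<notin> P" for j
        using f_P[OF that(1)] prime_over_diff_iff[OF is_subring_polys P(1), of "monom (U j)" "monom (V j)"]
          that keysU[OF that(1)] keysV[OF that(1)]
        unfolding H_def prime_lattice_def f_def by blast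
      \<comment> \<open>The terms of \<open>f j\<close> are congruent modulo \<open>P\<close>.
        Either both lie in \<open>P\<close> and are killed by variables in \<open>E\<close>, or
        neither does and their images differ by an element of \<open>H\<close>.\<close>
      have phi_f: "phi N l (f j) \<in> coset_ideal E H" if j: "j < s" for j
      proof (cases "monom (U j) \<in> P")
        case True
        then have "monom (V j) \<in> P"
          using f_P[OF j] prime_over_diff_iff[OF is_subring_polys P(1)] unfolding f_def by blast
        then show ?thesis
          using True pattern[OF keysU[OF j]] pattern[OF keysV[OF j]]
          by (simp add: f_def phi_binomial coset_ideal_diff monom_in_coset_ideal)
      next
        case False
        then have "monom (V j) \<notin> P"
          using f_P[OF j] prime_over_diff_iff[OF is_subring_polys P(1)] unfolding f_def by blast
        then show ?thesis
          using False f_H[OF j False] pattern[OF keysU[OF j]] pattern[OF keysV[OF j]] keysU[OF j] keysV[OF j]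
          by (simp add: f_def phi_binomial binomial_in_coset_ideal_iff[OF H] yvec_hat_exp)
      qed
      \<comment> \<open>For i in \<open>E\<close> the variable t_i lies in the coset ideal, and so
        do all \<open>phi N l (f j)\<close>. Thus (b) at i places a power of
        \<open>phi N l p\<close> there.\<close>
      have power: "\<exists>k. phi N l p ^ k \<in> coset_ideal E H" if p: "p \<in> IM" and i: "i \<in> E" for p i
      proof -
        have "phi N l p \<in> ?A i"
          using p ideal_span_superset[OF is_subring_polys, of "phi N l ` IM \<union> {var i}" l] by blast
        then have "phi N l p \<in> radical (polys l) (?A i)"
          by (auto simp: radical_def phi_in_polys intro: exI[of _ 1])
        moreover have "radical (polys l) (?A i) = radical (polys l) (?B i)"
          using ab[THEN conjunct2] i E by blast
        ultimately have "phi N l p \<in> radical (polys l) (?B i)" by (simp only:)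
        then obtain k where "phi N l p ^ k \<in> ?B i" by (auto simp: radical_def)
        moreover have "?B i \<subseteq> coset_ideal E H"
          using phi_f i
          by (intro ideal_span_minimal ideal_over_coset_ideal) (auto simp: var_def intro: monom_in_coset_ideal)
        ultimately show ?thesis by blast
      qed
      show "IM \<subseteq> P"
        unfolding IM_def
      proof (rule toric_ideal_subset[OF I])
        fix u v
        assume u: "Poly_Mapping.keys u \<subseteq> {..<n}" and v: "Poly_Mapping.keys v \<subseteq> {..<n}"
          and uv: "mat_exp M m u = mat_exp M m v"
        have IM: "monom u - monom v \<in> IM" "monom v - monom u \<in> IM"
          using u v uv by (simp_all add: IM_def binomial_in_toric_ideal_iff)
        show "monom u - monom v \<in> P"
        proof (cases "monom u \<in> P \<and> monom v \<in> P")
          case True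
          then show ?thesis by (intro ideal_over_diff[OF is_subring_polys I]) auto
        next
          case False
          have "\<exists>q. frob_exp TYPE('k) q \<and> (\<lambda>i. int q * yvec N l n (hat_exp u v) i) \<in> H"
          proof (cases "E = {}")
            case True
            \<comment> \<open>With \<open>E\<close> empty no monomial lies in \<open>P\<close>, so
              every \<open>f j\<close> contributes its vector to \<open>H\<close>.\<close>
            then have "G \<subseteq> H"
              unfolding G_def using pattern keysU f_H by (intro int_span_minimal[OF H]) blast
            moreover have "yvec N l n (hat_exp u v) \<in> NK"
              using u v uv by (auto simp: NK_def hat_exp_in_int_kernel_iff)
            ultimately show ?thesis using qa by blast
          next
            case False
            then obtain i where i: "i \<in> E" by blast
            \<comment> \<open>Both orders are needed: the mixed case, with one image meeting
              \<open>E\<close>, is refuted only when the other monomial comes first. That both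
              images meet \<open>E\<close> is excluded by the case assumption.\<close>
            obtain k1 k2 where k:
              "(monom (nat_mat_exp N l u) - monom (nat_mat_exp N l v)) ^ k1 \<in> (coset_ideal E H :: 'k mpoly set)"
              "(monom (nat_mat_exp N l v) - monom (nat_mat_exp N l u)) ^ k2 \<in> (coset_ideal E H :: 'k mpoly set)"
              using power[OF IM(1) i] power[OF IM(2) i] by (auto simp: phi_binomial)
            then have "Poly_Mapping.keys (nat_mat_exp N l u) \<inter> E = {}" "Poly_Mapping.keys (nat_mat_exp N l v) \<inter> E = {}"
              using \<open>\<not> (monom u \<in> P \<and> monom v \<in> P)\<close> pattern[OF u] pattern[OF v]
                binomial_power_notin_coset_ideal[OF H] by blast+
            then show ?thesis
              using binomial_power_in_coset_ideal[OF H _ _ k(1)] unfolding yvec_hat_exp[OF u v] by blast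
          qed
          then obtain q where q: "frob_exp TYPE('k) q" "(\<lambda>i. int q * yvec N l n (hat_exp u v) i) \<in> H" by blast
          \<comment> \<open>The multiplier q is absorbed into the exponents: x^(q u) - x^(q v) is
            handled by the lattice, and by the choice of q it equals (x^u - x^v)^q.\<close>
          have keys_scale: "Poly_Mapping.keys (exp_scale q u) \<subseteq> {..<n}" "Poly_Mapping.keys (exp_scale q v) \<subseteq> {..<n}"
            by (rule subset_trans[OF keys_exp_scale u], rule subset_trans[OF keys_exp_scale v])
          have "yvec N l n (hat_exp (exp_scale q u) (exp_scale q v)) \<in> prime_lattice N l n P"
            using q(2) unfolding H_def yvec_hat_exp[OF u v] yvec_hat_exp[OF keys_scale]
            by (simp add: nat_mat_exp_exp_scale right_diff_distrib)
          then have "monom (exp_scale q u) - monom (exp_scale q v) \<in> P"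
            by (rule binomial_in_prime_if_in_prime_lattice[OF P(1) IN_P[unfolded IN_def] keys_scale])
          then have "(monom u - monom v) ^ q \<in> P"
            by (simp add: frob_diff[OF q(1)] monom_power)
          moreover have "(monom u - monom v :: 'k mpoly) \<in> polys n"
            using IM(1) toric_ideal_subset_polys unfolding IM_def by blast
          ultimately show ?thesis using prime_over_power[OF is_subring_polys P(1)] by blast
        qed
      qed
    qed
    then have in_primes: "p \<in> P" if "p \<in> IM" "prime_over (polys n) P" "?J \<subseteq> P" for p P
      using that by blast
    have "IM \<subseteq> radical (polys n) ?J"
    proof
      fix p assume p: "p \<in> IM"
      then have "p \<in> polys n" by (simp add: IM_def toric_ideal_def)
      then show "p \<in> radical (polys n) ?J"
        using in_primes[OF p] by (intro in_radical_if_in_primes[OF is_subring_polys J])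
    qed
    moreover have "radical (polys n) ?J \<subseteq> IM"
      using J_sub toric_ideal_power unfolding radical_def IM_def by blast
    ultimately show ?rad by (rule subset_antisym)
  qed
qed

end
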